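(* Let $K_1$ and $K_2$ be compact Hausdorff spaces with finite, strictly positive, Borel measures $\mu_1$ and $\mu_2$, respectively. A map $h\colon \Delta(K_1,\mu_1)^\circ\to\Delta(K_2,\mu_2)^\circ$ is a surjective isometry with respect to Hilbert's metric $\delta_H$ if and only if there exist $\varepsilon\in\{-1,1\}$, a homeomorphism $\vartheta\colon K_2\to K_1$, and $g\in C(K_2)$ with $g(x)>0$ for all $x\in K_2$ such that $$h(f)=\frac{g\cdot (f\circ\vartheta)^{\varepsilon}}{\int g\cdot (f\circ\vartheta)^{\varepsilon}\,\mathrm{d}\mu_2}\qquad\text{for all } f\in\Delta(K_1,\mu_1)^\circ .$$ If $(K_1,\mu_1)=(K_2,\mu_2)=(K,\mu)$ and $|K|\ge 3$, then the isometry group is given by $$\mathrm{Isom}(\Delta(K,\mu)^\circ,\delta_H)\cong \overline{C(K)}\rtimes (C_2\times\mathrm{Homeo}(K)),$$ where $C_2$ is the cyclic group of order $2$, $\overline{C(K)}:=C(K)/\mathbb{R}\mathbf{1}$, and $\mathbf{1}$ is the constant one function on $K$.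
   Context: For a compact Hausdorff space $K$, $C(K)$ is the space of real-valued continuous functions on $K$. A finite Borel measure $\mu$ on $K$ is strictly positive if $\int f\,\mathrm{d}\mu>0$ for all $f\in C(K)$ with $f\ne 0$ and $f(x)\ge 0$ for all $x\in K$. For such $\mu$, $$\Delta(K,\mu)^\circ:=\{f\in C(K): f(x)>0\text{ for all }x\in K\text{ and }\textstyle\int f\,\mathrm{d}\mu=1\}.$$ This is a convex subset of $C(K)$ such that each straight line $\ell_{fg}$ through distinct points $f,g$ of it meets it in an open and bounded line segment. Hilbert's metric $\delta_H$ on it is defined as follows: for $f\neq g$ let $f',g'$ be the end-points of the segment $\ell_{fg}\cap\Delta(K,\mu)^\circ$, with $f$ between $f'$ and $g$, and $g$ between $g'$ and $f$, and put $$\delta_H(f,g)=\log\left(\frac{|f'-g|}{|f'-f|}\,\frac{|g'-f|}{|g'-g|}\right),\qquad \delta_H(f,f)=0,$$ where $|\cdot|$ denotes length along the line. $\mathrm{Isom}$ denotes the group of surjective isometries of the space onto itself, and $\mathrm{Homeo}(K)$ the group of homeomorphisms of $K$ onto itself. In the semidirect product, $\overline{C(K)}$ is regarded as an additive group, the generator of $C_2$ acts on it by multiplication by $-1$, and $\vartheta\in\mathrm{Homeo}(K)$ acts on $\overline{f}\in\overline{C(K)}$ by $\overline{f}\mapsto\overline{f\circ\vartheta^{-1}}$. *)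

theory Defs
  imports "HOL-Analysis.Analysis" "HOL-Algebra.Elementary_Groups"
begin

text \<open>
  A compact Hausdorff space is a \<^typ>\<open>'a topology\<close> \<open>K\<close> with \<open>compact_space K\<close> and
  \<open>Hausdorff_space K\<close>. Functions on \<open>K\<close> are extensional on \<open>topspace K\<close>, so that equality of
  HOL functions is equality of functions on \<open>K\<close>.
\<close>

definition C_space :: "'a topology \<Rightarrow> ('a \<Rightarrow> real) set" where
  "C_space K = {f \<in> extensional (topspace K). continuous_map K euclideanreal f}"

definition finite_Borel_measure :: "'a topology \<Rightarrow> 'a measure \<Rightarrow> bool" where
  "finite_Borel_measure K M \<longleftrightarrow>
     finite_measure M \<and> sets M = sets (sigma (topspace K) {U. openin K U})"

definition strictly_positive :: "'a topology \<Rightarrow> 'a measure \<Rightarrow> bool" where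
  "strictly_positive K M \<longleftrightarrow>
     (\<forall>f \<in> C_space K. (\<exists>x \<in> topspace K. f x \<noteq> 0) \<and> (\<forall>x \<in> topspace K. 0 \<le> f x)
        \<longrightarrow> 0 < (LINT x|M. f x))"

definition Delta :: "'a topology \<Rightarrow> 'a measure \<Rightarrow> ('a \<Rightarrow> real) set" where
  "Delta K M = {f \<in> C_space K. (\<forall>x \<in> topspace K. 0 < f x) \<and> (LINT x|M. f x) = 1}"

definition line_point :: "'a topology \<Rightarrow> ('a \<Rightarrow> real) \<Rightarrow> ('a \<Rightarrow> real) \<Rightarrow> real \<Rightarrow> ('a \<Rightarrow> real)" where
  "line_point K f g t = (\<lambda>x \<in> topspace K. (1 - t) * f x + t * g x)"

definition segment_params ::
    "'a topology \<Rightarrow> 'a measure \<Rightarrow> ('a \<Rightarrow> real) \<Rightarrow> ('a \<Rightarrow> real) \<Rightarrow> real set" where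
  "segment_params K M f g = {t. line_point K f g t \<in> Delta K M}"

text \<open>
  For \<open>f \<noteq> g\<close> in \<open>Delta K M\<close> the set \<open>segment_params K M f g\<close> is a bounded open interval containing
  0 (the point \<open>f\<close>) and 1 (the point \<open>g\<close>), so the end-point on the side of \<open>f\<close> has the infimum
  and the one on the side of \<open>g\<close> the supremum as its parameter. Lengths are taken in the supremum
  norm of \<open>C(K)\<close>; the cross-ratio does not depend on how length along the line is normalised.
\<close>

definition hilbert_dist ::
    "'a topology \<Rightarrow> 'a measure \<Rightarrow> ('a \<Rightarrow> real) \<Rightarrow> ('a \<Rightarrow> real) \<Rightarrow> real" where
  "hilbert_dist K M f g =
     (if f = g then 0
      else let f' = line_point K f g (Inf (segment_params K M f g));
               g' = line_point K f g (Sup (segment_params K M f g));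
               len = mdist (cfunspace K euclidean_metric)
           in ln ((len f' g / len f' f) * (len g' f / len g' g)))"

definition surjective_isometry ::
    "'a set \<Rightarrow> ('a \<Rightarrow> 'a \<Rightarrow> real) \<Rightarrow> 'b set \<Rightarrow> ('b \<Rightarrow> 'b \<Rightarrow> real) \<Rightarrow> ('a \<Rightarrow> 'b) \<Rightarrow> bool" where
  "surjective_isometry A d B e h \<longleftrightarrow>
     h ` A = B \<and> (\<forall>x \<in> A. \<forall>y \<in> A. e (h x) (h y) = d x y)"

definition Isom :: "'a set \<Rightarrow> ('a \<Rightarrow> 'a \<Rightarrow> real) \<Rightarrow> ('a \<Rightarrow> 'a) monoid" where
  "Isom A d =
     \<lparr>carrier = {h \<in> extensional A. surjective_isometry A d A d h},
      mult = compose A,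
      one = (\<lambda>x \<in> A. x)\<rparr>"

definition Homeo :: "'a topology \<Rightarrow> ('a \<Rightarrow> 'a) monoid" where
  "Homeo K =
     \<lparr>carrier = {\<theta> \<in> extensional (topspace K). homeomorphic_map K K \<theta>},
      mult = compose (topspace K),
      one = (\<lambda>x \<in> topspace K. x)\<rparr>"

definition C_group :: "'a topology \<Rightarrow> ('a \<Rightarrow> real) monoid" where
  "C_group K =
     \<lparr>carrier = C_space K,
      mult = (\<lambda>f g. \<lambda>x \<in> topspace K. f x + g x),
      one = (\<lambda>x \<in> topspace K. 0)\<rparr>"

definition constants :: "'a topology \<Rightarrow> ('a \<Rightarrow> real) set" where
  "constants K = range (\<lambda>c. \<lambda>x \<in> topspace K. c)"

definition C_bar :: "'a topology \<Rightarrow> ('a \<Rightarrow> real) set monoid" where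
  "C_bar K = C_group K Mod constants K"

definition semidirect_product ::
    "('n, 'u) monoid_scheme \<Rightarrow> ('h, 'v) monoid_scheme \<Rightarrow> ('h \<Rightarrow> 'n \<Rightarrow> 'n) \<Rightarrow> ('n \<times> 'h) monoid" where
  "semidirect_product N H \<alpha> =
     \<lparr>carrier = carrier N \<times> carrier H,
      mult = (\<lambda>(n, h) (n', h'). (n \<otimes>\<^bsub>N\<^esub> \<alpha> h n', h \<otimes>\<^bsub>H\<^esub> h')),
      one = (\<one>\<^bsub>N\<^esub>, \<one>\<^bsub>H\<^esub>)\<rparr>"

text \<open>
  The group \<open>C\<^sub>2\<close> is \<open>integer_mod_group 2\<close> with carrier \<open>{0, 1}\<close>. The action is on cosets:
  the image of the coset of \<open>f\<close> is the coset of \<open>(-1)\<^sup>k (f \<circ> \<theta>\<^sup>-\<^sup>1)\<close>.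
\<close>

definition C_bar_action ::
    "'a topology \<Rightarrow> int \<times> ('a \<Rightarrow> 'a) \<Rightarrow> ('a \<Rightarrow> real) set \<Rightarrow> ('a \<Rightarrow> real) set" where
  "C_bar_action K = (\<lambda>(k, \<theta>) F.
     (\<lambda>f. \<lambda>x \<in> topspace K. (-1) powi k * f (inv_into (topspace K) \<theta> x)) ` F)"

end

theory Submission
  imports Defs
begin

text \<open>
  In logarithmic coordinates Hilbert's metric becomes the distance
  \<open>max (u - v) - min (u - v)\<close> on \<open>C(K)\<close> modulo constants, and pointwise inversion through a
  point becomes a point reflection. Reflections suffice for Vaisala's proof of the Mazur--Ulam
  theorem, so isometries preserve geometric means, i.e. are additive up to a translation.
  For an additive isometry \<open>S\<close> and points \<open>x \<noteq> y\<close>, the functions of oscillation one that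
  peak at \<open>x\<close> and \<open>y\<close> all have images peaking at a common pair \<open>(p, q)\<close>, by compactness; adding
  a large multiple of such a function to \<open>v\<close> yields \<open>v x - v y = S v p - S v q\<close> for all \<open>v\<close>.
  Comparing these identities for triples of points shows that the pairs \<open>(p, q)\<close> share either
  always the first or always the second point, which determines \<open>\<theta>\<close> and \<open>\<epsilon>\<close>.
\<close>

section \<open>A metric form of the Mazur--Ulam theorem\<close>

text \<open>\<open>Delta K M\<close> is not a vector space, so the Mazur--Ulam theorem is stated for
  bare metric spaces with an involution that doubles distances to its centre. Preservation of
  midpoints yields additivity, and additivity is enough, because the multiples in the peak argument
  can be natural numbers. Constants are not divided out there: representatives are kept and only
  differences of values are compared, the normalisation in \<open>Delta K M\<close> absorbing the
  constant. The argument runs on the inverse of the given isometry, so that the map of points comes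
  out in the direction from the second space to the first. The duality behind it: differences of two
  distinct point masses are the extreme points of the dual unit ball for the oscillation, and the
  adjoint of a linear isometry permutes them. Three points are essential for the group: on a
  two-point space, exchanging the points negates every function modulo constants, so an isometry
  determines neither the sign nor the homeomorphism.\<close>

lemma metric_midpoint_fixed:
  assumes "Metric_space X d"
    and \<rho>: "\<rho> \<in> X \<rightarrow> X" "\<And>x. x \<in> X \<Longrightarrow> \<rho> (\<rho> x) = x"
      "\<And>x y. \<lbrakk>x \<in> X; y \<in> X\<rbrakk> \<Longrightarrow> d (\<rho> x) (\<rho> y) = d x y"
      "\<And>x. x \<in> X \<Longrightarrow> d (\<rho> x) x = 2 * d x m"
    and m: "m \<in> X" and a: "a \<in> X"
    and g: "bij_betw g X X" "\<And>x y. \<lbrakk>x \<in> X; y \<in> X\<rbrakk> \<Longrightarrow> d (g x) (g y) = d x y"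
      "g a = a" "g (\<rho> a) = \<rho> a"
  shows "g m = m"
proof -
  interpret Metric_space X d by fact
  have \<rho>X: "\<rho> x \<in> X" if "x \<in> X" for x using \<rho>(1) that by auto
  have \<rho>m: "\<rho> m = m" using \<rho>(4)[OF m] m \<rho>X by simp
  \<comment> \<open>The bound is uniform in \<open>g\<close>: a map fixing \<open>a\<close>
    displaces \<open>m\<close> by at most \<open>2 * d a m\<close>. The induction replaces
    \<open>g\<close> by a map of the same kind that displaces \<open>m\<close> twice as far, so the
    displacement has to be zero.\<close>
  have bound: "2 ^ n * d (g m) m \<le> 2 * d a m"
    if "bij_betw g X X" "\<And>x y. \<lbrakk>x \<in> X; y \<in> X\<rbrakk> \<Longrightarrow> d (g x) (g y) = d x y"
      "g a = a" "g (\<rho> a) = \<rho> a" for n g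
    using that
  proof (induction n arbitrary: g)
    case 0
    have "g m \<in> X" using 0(1) m by (auto dest: bij_betwE)
    then have "d (g m) m \<le> d (g m) (g a) + d (g a) m" 
      using triangle[of "g m" a m] a m 0 by simp
    moreover have "d (g m) (g a) = d m a" using 0(2) a m by blast
    ultimately show ?case using 0(3) commute[of m a] by simp
  next
    case (Suc n)
    define k where "k = inv_into X g"
    have gX: "g x \<in> X" if "x \<in> X" for x using Suc.prems(1) that by (auto dest: bij_betwE)
    have k: "bij_betw k X X" unfolding k_def by (rule bij_betw_inv_into) fact
    have kX: "k x \<in> X" if "x \<in> X" for x using k that by (auto dest: bij_betwE)
    have gk: "g (k x) = x" if "x \<in> X" for x
      unfolding k_def using Suc.prems(1) that by (simp add: bij_betw_inv_into_right)
    have kg: "k (g x) = x" if "x \<in> X" for x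
      unfolding k_def using Suc.prems(1) that by (simp add: bij_betw_inv_into_left)
    have kd: "d (k x) (k y) = d x y" if "x \<in> X" "y \<in> X" for x y
      using Suc.prems(2)[of "k x" "k y"] that kX gk by simp
    \<comment> \<open>Moving \<open>\<rho>\<close> and \<open>k\<close> to the other argument as
      isometries turns the displacement of \<open>m\<close> under \<open>?h\<close> into the
      distance between \<open>\<rho> (g m)\<close> and \<open>g m\<close>, which is twice that
      between \<open>g m\<close> and \<open>m\<close>.\<close>
    let ?h = "\<lambda>x. \<rho> (k (\<rho> (g x)))"
    have "bij_betw \<rho> X X"
      by (rule bij_betwI[where g = \<rho>]) (use \<rho> in auto)
    then have "bij_betw (\<rho> \<circ> (k \<circ> (\<rho> \<circ> g))) X X"
      using k Suc.prems(1) by (meson bij_betw_trans)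
    then have 1: "bij_betw ?h X X" by (simp add: o_def)
    have 2: "d (?h x) (?h y) = d x y" if "x \<in> X" "y \<in> X" for x y
      using that gX kX \<rho>X \<rho>(3) kd Suc.prems(2) by simp
    have 3: "?h a = a" using Suc.prems(3,4) a kg[of "\<rho> a"] \<rho>X \<rho>(2) by simp
    have 4: "?h (\<rho> a) = \<rho> a" using Suc.prems(3,4) a kg[of a] \<rho>(2) by simp
    have "d (?h m) m = d (?h m) (\<rho> m)" using \<rho>m by simp
    also have "\<dots> = d (k (\<rho> (g m))) (k (g m))" using m gX kX \<rho>X \<rho>(3) kg by simp
    also have "\<dots> = 2 * d (g m) m" using m gX \<rho>X kd \<rho>(4) by simp
    finally show ?case using Suc.IH[of ?h] 1 2 3 4 by (simp add: mult.assoc)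
  qed
  have gm: "g m \<in> X" using g(1) m by (auto dest: bij_betwE)
  have "d (g m) m \<le> 0"
  proof (rule ccontr)
    assume "\<not> d (g m) m \<le> 0"
    then have pos: "0 < d (g m) m" by simp
    then obtain n where "2 * d a m / d (g m) m < 2 ^ n"
      using real_arch_pow[of 2] by auto
    then have "2 * d a m < 2 ^ n * d (g m) m" using pos by (simp add: field_simps)
    then show False using bound[OF g, of n] by simp
  qed
  then show ?thesis using gm m nonneg[of "g m" m] by simp
qed

text \<open>The preceding lemma applies to \<open>\<rho>\<close>, the inverse of \<open>h\<close>,
  \<open>\<sigma>\<close> and \<open>h\<close> composed in this order: the condition on
  \<open>a\<close> says that this loop fixes \<open>a\<close> and \<open>\<rho> a\<close>. Hence it
  fixes \<open>m\<close>, so \<open>\<sigma>\<close> fixes \<open>h m\<close>; but distance doubling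
  leaves \<open>m'\<close> as the only fixed point of \<open>\<sigma>\<close>.\<close>

theorem metric_Mazur_Ulam:
  assumes "Metric_space X d" "Metric_space Y e"
    and h: "h ` X = Y" "\<And>x y. \<lbrakk>x \<in> X; y \<in> X\<rbrakk> \<Longrightarrow> e (h x) (h y) = d x y"
    and \<rho>: "\<rho> \<in> X \<rightarrow> X" "\<And>x. x \<in> X \<Longrightarrow> \<rho> (\<rho> x) = x"
      "\<And>x y. \<lbrakk>x \<in> X; y \<in> X\<rbrakk> \<Longrightarrow> d (\<rho> x) (\<rho> y) = d x y"
      "\<And>x. x \<in> X \<Longrightarrow> d (\<rho> x) x = 2 * d x m"
    and \<sigma>: "\<sigma> \<in> Y \<rightarrow> Y" "\<And>x. x \<in> Y \<Longrightarrow> \<sigma> (\<sigma> x) = x"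
      "\<And>x y. \<lbrakk>x \<in> Y; y \<in> Y\<rbrakk> \<Longrightarrow> e (\<sigma> x) (\<sigma> y) = e x y"
      "\<And>x. x \<in> Y \<Longrightarrow> e (\<sigma> x) x = 2 * e x m'"
    and m: "m \<in> X" "m' \<in> Y" and a: "a \<in> X" "\<sigma> (h a) = h (\<rho> a)"
  shows "h m = m'"
proof -
  interpret X: Metric_space X d by fact
  interpret Y: Metric_space Y e by fact
  have hX: "h x \<in> Y" if "x \<in> X" for x using h(1) that by auto
  have \<rho>X: "\<rho> x \<in> X" if "x \<in> X" for x using \<rho>(1) that by auto
  have \<sigma>Y: "\<sigma> x \<in> Y" if "x \<in> Y" for x using \<sigma>(1) that by auto
  have "inj_on h X"
  proof (rule inj_onI)
    fix x y assume xy: "x \<in> X" "y \<in> X" "h x = h y"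
    then have "d x y = 0" using h(2)[of x y] hX by simp
    then show "x = y" using xy by simp
  qed
  then have bij: "bij_betw h X Y" using h(1) by (simp add: bij_betw_def)
  define k where "k = inv_into X h"
  have k: "bij_betw k Y X" unfolding k_def by (rule bij_betw_inv_into) fact
  have kY: "k y \<in> X" if "y \<in> Y" for y using k that by (auto dest: bij_betwE)
  have hk: "h (k y) = y" if "y \<in> Y" for y
    unfolding k_def using bij that by (simp add: bij_betw_inv_into_right)
  have kh: "k (h x) = x" if "x \<in> X" for x
    unfolding k_def using bij that by (simp add: bij_betw_inv_into_left)
  have kd: "d (k x) (k y) = e x y" if "x \<in> Y" "y \<in> Y" for x y
    using h(2)[of "k x" "k y"] that kY hk by simp
  let ?g = "\<lambda>x. \<rho> (k (\<sigma> (h x)))"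
  have "bij_betw \<rho> X X" "bij_betw \<sigma> Y Y"
    by (rule bij_betwI[where g = \<rho>], use \<rho> in auto)
       (rule bij_betwI[where g = \<sigma>], use \<sigma> in auto)
  then have "bij_betw (\<rho> \<circ> (k \<circ> (\<sigma> \<circ> h))) X X" using k bij by (meson bij_betw_trans)
  then have 1: "bij_betw ?g X X" by (simp add: o_def)
  have 2: "d (?g x) (?g y) = d x y" if "x \<in> X" "y \<in> X" for x y
    using that hX kY \<rho>X \<sigma>Y \<rho>(3) \<sigma>(3) kd h(2) by simp
  have 3: "?g a = a" using a kh[of "\<rho> a"] \<rho>X \<rho>(2) by simp
  have "\<sigma> (h (\<rho> a)) = h a" using \<sigma>(2)[of "h a"] a hX by simp
  then have 4: "?g (\<rho> a) = \<rho> a" using a kh[of a] by simp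
  have "?g m = m"
    by (rule metric_midpoint_fixed[of X d \<rho> m a]) (use assms 1 2 3 4 in auto)
  then have "\<rho> (?g m) = \<rho> m" by simp
  moreover have "\<rho> m = m" using \<rho>(4)[OF m(1)] m \<rho>X by simp
  ultimately have "k (\<sigma> (h m)) = m" using \<rho>(2)[of "k (\<sigma> (h m))"] m kY \<sigma>Y hX by simp
  then have "\<sigma> (h m) = h m" using hk[of "\<sigma> (h m)"] m \<sigma>Y hX by simp
  then have "e (h m) m' = 0" using \<sigma>(4)[of "h m"] m hX by simp
  then show ?thesis using m hX by simp
qed

section \<open>Oscillation seminorm on a compact Hausdorff space\<close>

lemma continuous_map_real_exp:
  "continuous_map X euclideanreal f \<Longrightarrow> continuous_map X euclideanreal (\<lambda>x. exp (f x))"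
  by (simp add: continuous_map_atin tendsto_exp)

lemma continuous_map_real_ln:
  "\<lbrakk>continuous_map X euclideanreal f; \<And>x. x \<in> topspace X \<Longrightarrow> 0 < f x\<rbrakk>
    \<Longrightarrow> continuous_map X euclideanreal (\<lambda>x. ln (f x))"
  unfolding continuous_map_atin limitin_canonical_iff by (intro ballI tendsto_ln) force+

text \<open>On continuous functions on a nonempty compact space this is twice the quotient norm that
  the supremum norm induces modulo constants.\<close>

definition osc :: "'a topology \<Rightarrow> ('a \<Rightarrow> real) \<Rightarrow> real" where
  "osc K u = (SUP x\<in>topspace K. u x) - (INF x\<in>topspace K. u x)"

text \<open>Nonemptiness makes the supremum and infimum in \<open>osc\<close> attained values; empty
  spaces are settled separately at the end.\<close>

locale compact_Hausdorff =
  fixes K :: "'a topology"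
  assumes compact: "compact_space K" and Hausdorff: "Hausdorff_space K"
    and nonempty: "topspace K \<noteq> {}"
begin

lemma attains_sup:
  assumes "continuous_map K euclideanreal u"
  obtains x where "x \<in> topspace K" "\<forall>y\<in>topspace K. u y \<le> u x"
proof -
  have "compact (u ` topspace K)"
    using image_compactin[OF compact[unfolded compact_space_def] assms] by simp
  from compact_attains_sup[OF this] nonempty
  have "\<exists>x\<in>topspace K. \<forall>y\<in>topspace K. u y \<le> u x" by auto
  then show ?thesis using that by blast
qed

lemma attains_inf:
  assumes "continuous_map K euclideanreal u"
  obtains x where "x \<in> topspace K" "\<forall>y\<in>topspace K. u x \<le> u y"
proof -
  obtain x where "x \<in> topspace K" "\<forall>y\<in>topspace K. - u y \<le> - u x"
    by (rule attains_sup[OF continuous_map_minus[OF assms]])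
  then show thesis using that[of x] by simp
qed

lemma osc_eqI:
  assumes "x \<in> topspace K" "y \<in> topspace K"
    and "\<And>s t. \<lbrakk>s \<in> topspace K; t \<in> topspace K\<rbrakk> \<Longrightarrow> u s - u t \<le> u x - u y"
  shows "osc K u = u x - u y"
proof -
  have "u s \<le> u x" "u y \<le> u s" if "s \<in> topspace K" for s
    using assms(3)[OF that assms(2)] assms(3)[OF assms(1) that] by simp_all
  then have "(SUP z\<in>topspace K. u z) = u x" "(INF z\<in>topspace K. u z) = u y"
    using assms(1,2) by (auto intro: cSup_eq_maximum cInf_eq_minimum)
  then show ?thesis by (simp add: osc_def)
qed

text \<open>Extremality is stated for the pair of points, so that the congruence, scaling and
  negation rules can carry the same pair over to another function and conclude by
  \<open>osc_eqI\<close>.\<close>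

lemma osc_attained:
  assumes "continuous_map K euclideanreal u"
  obtains x y where "x \<in> topspace K" "y \<in> topspace K" "osc K u = u x - u y"
    "\<forall>s\<in>topspace K. \<forall>t\<in>topspace K. u s - u t \<le> u x - u y"
proof -
  obtain x where x: "x \<in> topspace K" "\<forall>y\<in>topspace K. u y \<le> u x"
    by (rule attains_sup[OF assms])
  obtain y where y: "y \<in> topspace K" "\<forall>z\<in>topspace K. u y \<le> u z"
    by (rule attains_inf[OF assms])
  have le: "u s - u t \<le> u x - u y" if "s \<in> topspace K" "t \<in> topspace K" for s t
    using x(2) y(2) that by (simp add: diff_mono)
  show thesis using that[OF x(1) y(1) osc_eqI[OF x(1) y(1) le]] le by blast
qed

lemma osc_upper:
  assumes "continuous_map K euclideanreal u" "x \<in> topspace K" "y \<in> topspace K"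
  shows "u x - u y \<le> osc K u"
proof -
  obtain s t where "osc K u = u s - u t"
    "\<forall>s'\<in>topspace K. \<forall>t'\<in>topspace K. u s' - u t' \<le> u s - u t"
    by (rule osc_attained[OF assms(1)])
  then show ?thesis using assms by simp
qed

lemma osc_le_iff:
  assumes "continuous_map K euclideanreal u"
  shows "osc K u \<le> B \<longleftrightarrow> (\<forall>x\<in>topspace K. \<forall>y\<in>topspace K. u x - u y \<le> B)"
proof
  obtain s t where "s \<in> topspace K" "t \<in> topspace K" "osc K u = u s - u t"
    by (rule osc_attained[OF assms])
  then show "osc K u \<le> B" if "\<forall>x\<in>topspace K. \<forall>y\<in>topspace K. u x - u y \<le> B"
    using that by simp
  show "\<forall>x\<in>topspace K. \<forall>y\<in>topspace K. u x - u y \<le> B" if "osc K u \<le> B"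
    using osc_upper[OF assms] order_trans[OF _ that] by simp
qed

lemma osc_nonneg:
  assumes "continuous_map K euclideanreal u"
  shows "0 \<le> osc K u"
proof -
  obtain x where "x \<in> topspace K" using nonempty by blast
  then show ?thesis using osc_upper[OF assms, of x x] by simp
qed

lemma osc_eq_0_iff:
  assumes "continuous_map K euclideanreal u"
  shows "osc K u = 0 \<longleftrightarrow> (\<forall>x\<in>topspace K. \<forall>y\<in>topspace K. u x = u y)"
proof -
  have "osc K u = 0 \<longleftrightarrow> osc K u \<le> 0" using osc_nonneg[OF assms] by auto
  also have "\<dots> \<longleftrightarrow> (\<forall>x\<in>topspace K. \<forall>y\<in>topspace K. u x = u y)"
    unfolding osc_le_iff[OF assms] by (metis diff_le_0_iff_le order.antisym order.refl)
  finally show ?thesis .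
qed

lemma osc_triangle:
  assumes "continuous_map K euclideanreal u" "continuous_map K euclideanreal v"
  shows "osc K (\<lambda>x. u x + v x) \<le> osc K u + osc K v"
proof -
  have "u x + v x - (u y + v y) \<le> osc K u + osc K v" if "x \<in> topspace K" "y \<in> topspace K" for x y
    using osc_upper[OF assms(1) that] osc_upper[OF assms(2) that] by simp
  then show ?thesis by (simp add: osc_le_iff assms continuous_map_add)
qed

lemma osc_cong:
  assumes "\<And>x y. \<lbrakk>x \<in> topspace K; y \<in> topspace K\<rbrakk> \<Longrightarrow> u x - u y = v x - v y"
    and "continuous_map K euclideanreal u"
  shows "osc K u = osc K v"
proof -
  obtain x y where xy: "x \<in> topspace K" "y \<in> topspace K" "osc K u = u x - u y"
    "\<forall>s\<in>topspace K. \<forall>t\<in>topspace K. u s - u t \<le> u x - u y"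
    by (rule osc_attained[OF assms(2)])
  have "v s - v t \<le> v x - v y" if "s \<in> topspace K" "t \<in> topspace K" for s t
    using xy(4) that assms(1)[OF that] assms(1)[OF xy(1,2)] by metis
  then have "osc K v = v x - v y" using osc_eqI[OF xy(1,2), of v] by blast
  then show ?thesis using xy(3) assms(1)[OF xy(1,2)] by linarith
qed

lemma osc_scale_nonneg:
  assumes "continuous_map K euclideanreal u" "0 \<le> c"
  shows "osc K (\<lambda>x. c * u x) = c * osc K u"
proof -
  obtain x y where xy: "x \<in> topspace K" "y \<in> topspace K" "osc K u = u x - u y"
    "\<forall>s\<in>topspace K. \<forall>t\<in>topspace K. u s - u t \<le> u x - u y"
    by (rule osc_attained[OF assms(1)])
  have "c * u s - c * u t \<le> c * u x - c * u y" if "s \<in> topspace K" "t \<in> topspace K" for s t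
    using xy(4) that assms(2) by (simp add: mult_left_mono flip: right_diff_distrib)
  then have "osc K (\<lambda>x. c * u x) = c * u x - c * u y"
    using osc_eqI[OF xy(1,2), of "\<lambda>x. c * u x"] by blast
  then show ?thesis using xy(3) by (simp add: right_diff_distrib)
qed

lemma osc_minus:
  assumes "continuous_map K euclideanreal u"
  shows "osc K (\<lambda>x. - u x) = osc K u"
proof -
  obtain x y where xy: "x \<in> topspace K" "y \<in> topspace K" "osc K u = u x - u y"
    "\<forall>s\<in>topspace K. \<forall>t\<in>topspace K. u s - u t \<le> u x - u y"
    by (rule osc_attained[OF assms])
  have "- u s - - u t \<le> - u y - - u x" if "s \<in> topspace K" "t \<in> topspace K" for s t
    using xy(4) that by simp
  then have "osc K (\<lambda>x. - u x) = - u y - - u x"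
    using osc_eqI[OF xy(2,1), of "\<lambda>x. - u x"] by blast
  then show ?thesis using xy(3) by simp
qed

lemma osc_diff_commute:
  assumes "continuous_map K euclideanreal u" "continuous_map K euclideanreal v"
  shows "osc K (\<lambda>x. u x - v x) = osc K (\<lambda>x. v x - u x)"
  using osc_minus[OF continuous_map_diff[OF assms]] by simp

section \<open>Urysohn functions\<close>

lemma bump:
  assumes "openin K U" "x \<in> U"
  obtains p where "continuous_map K euclideanreal p" "p x = 1"
    "\<forall>y\<in>topspace K. 0 \<le> p y \<and> p y \<le> 1" "\<forall>y\<in>topspace K - U. p y = 0"
proof -
  have "normal_space K"
    using compact Hausdorff compact_Hausdorff_or_regular_imp_normal_space by blast
  moreover have x: "x \<in> topspace K" using assms openin_subset by blast
  moreover have "closedin K (topspace K - U)" "closedin K {x}"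
    using assms(1) x Hausdorff by (auto simp: closedin_Hausdorff_finite)
  moreover have "disjnt (topspace K - U) {x}" using assms(2) by simp
  ultimately obtain p where p: "continuous_map K (top_of_set {0..1::real}) p"
      "p ` (topspace K - U) \<subseteq> {0}" "p ` {x} \<subseteq> {1}"
    using Urysohn_lemma[of K "topspace K - U" "{x}" 0 1] zero_le_one by metis
  show thesis
  proof (rule that)
    show "continuous_map K euclideanreal p" using p(1) continuous_map_in_subtopology by blast
    show "\<forall>y\<in>topspace K. 0 \<le> p y \<and> p y \<le> 1"
      using p(1) by (auto simp: continuous_map_in_subtopology image_subset_iff)
  qed (use p in auto)
qed

text \<open>These functions serve as test functions: they isolate one term in an identity between
  finitely many point evaluations.\<close>

lemma finite_indicator:
  assumes "x \<in> topspace K" "finite A" "x \<notin> A" "A \<subseteq> topspace K"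
  obtains u where "continuous_map K euclideanreal u" "u x = 1" "\<forall>y\<in>A. u y = 0"
proof -
  have "openin K (topspace K - A)"
    using assms Hausdorff by (simp add: closedin_Hausdorff_finite openin_diff)
  moreover have "x \<in> topspace K - A" using assms by simp
  ultimately obtain p where "continuous_map K euclideanreal p" "p x = 1"
    "\<forall>y\<in>topspace K - (topspace K - A). p y = 0"
    by (rule bump)
  then show thesis using that[of p] assms(4) by auto
qed

end

section \<open>Oscillation-preserving additive maps\<close>

context compact_Hausdorff begin

text \<open>The maximum of \<open>N * w + v\<close> can exceed \<open>N + v x\<close> only slightly:
  near \<open>x\<close> the function \<open>v\<close> is itself at most
  \<open>v x + \<epsilon> / 2\<close>, and elsewhere \<open>w\<close> is at most
  \<open>1 / 2\<close>, a loss of \<open>N / 2\<close>, which outweighs the oscillation of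
  \<open>v\<close>. The minimum near \<open>y\<close> is treated symmetrically, and each side
  contributes half of \<open>\<epsilon>\<close>.\<close>

lemma peak_function:
  assumes v: "continuous_map K euclideanreal v"
    and xy: "x \<in> topspace K" "y \<in> topspace K" "x \<noteq> y"
    and \<epsilon>: "0 < \<epsilon>" and N: "2 * osc K v \<le> N"
  obtains w where "continuous_map K euclideanreal w" "osc K w = 1" "w x - w y = 1"
    "osc K (\<lambda>s. N * w s + v s) \<le> N + (v x - v y) + \<epsilon>"
proof -
  have N0: "0 \<le> N" using osc_nonneg[OF v] N by simp
  \<comment> \<open>Removing \<open>y\<close> from \<open>U\<close> and \<open>x\<close> from
    \<open>V\<close> forces \<open>p y = 0\<close> and \<open>q x = 0\<close>, so that
    \<open>w\<close> takes exactly the values 1 at \<open>x\<close> and 0 at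
    \<open>y\<close>.\<close>
  define U where "U = {s \<in> topspace K. v s < v x + \<epsilon> / 2} - {y}"
  define V where "V = {s \<in> topspace K. v y - \<epsilon> / 2 < v s} - {x}"
  have "openin K {s \<in> topspace K. v s \<in> {..< v x + \<epsilon> / 2}}"
    "openin K {s \<in> topspace K. v s \<in> {v y - \<epsilon> / 2 <..}}"
    by (rule openin_continuous_map_preimage[OF v], simp)+
  then have "openin K U" "openin K V"
    unfolding U_def V_def using Hausdorff xy(1,2)
    by (simp_all add: openin_diff closedin_Hausdorff_finite)
  moreover have "x \<in> U" "y \<in> V" using xy \<epsilon> by (auto simp: U_def V_def)
  ultimately have op: "openin K U" "x \<in> U" "openin K V" "y \<in> V" by simp_all
  obtain p where p: "continuous_map K euclideanreal p" "p x = 1"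
       "\<forall>s\<in>topspace K. 0 \<le> p s \<and> p s \<le> 1" "\<forall>s\<in>topspace K - U. p s = 0"
    by (rule bump[OF op(1,2)])
  obtain q where q: "continuous_map K euclideanreal q" "q y = 1"
       "\<forall>s\<in>topspace K. 0 \<le> q s \<and> q s \<le> 1" "\<forall>s\<in>topspace K - V. q s = 0"
    by (rule bump[OF op(3,4)])
  \<comment> \<open>This average lies between 0 and 1, is at most \<open>1 / 2\<close> off
    \<open>U\<close> and at least \<open>1 / 2\<close> off \<open>V\<close>. It works even when
    \<open>U\<close> and \<open>V\<close> overlap.\<close>
  define w where "w s = (1 / 2) * (1 + p s - q s)" for s
  have w: "continuous_map K euclideanreal w"
    unfolding w_def using p(1) q(1)
    by (intro continuous_map_real_mult continuous_map_diff continuous_map_add) auto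
  have "p y = 0" "q x = 0" using p(4) q(4) xy by (auto simp: U_def V_def)
  then have wxy: "w x = 1" "w y = 0" using p(2) q(2) by (simp_all add: w_def)
  have w01: "0 \<le> w s" "w s \<le> 1" if "s \<in> topspace K" for s
    using p(3) q(3) that by (fastforce simp: w_def)+
  have up: "N * w s + v s \<le> N + v x + \<epsilon> / 2" if s: "s \<in> topspace K" for s
  proof (cases "s \<in> U")
    case True
    then show ?thesis using mult_left_mono[OF w01(2)[OF s] N0] by (simp add: U_def)
  next
    case False
    then have "p s = 0" using p(4) s by simp
    then have "w s \<le> 1 / 2" using q(3) s by (simp add: w_def)
    then have "N * w s \<le> N * (1 / 2)" using N0 by (rule mult_left_mono)
    moreover have "v s - v x \<le> N / 2" using osc_upper[OF v s xy(1)] N by simp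
    ultimately show ?thesis using \<epsilon> by simp
  qed
  have low: "v y - \<epsilon> / 2 \<le> N * w s + v s" if s: "s \<in> topspace K" for s
  proof (cases "s \<in> V")
    case True
    then show ?thesis using mult_nonneg_nonneg[OF N0 w01(1)[OF s]] by (simp add: V_def)
  next
    case False
    then have "q s = 0" using q(4) s by simp
    then have "1 / 2 \<le> w s" using p(3) s by (simp add: w_def)
    then have "N * (1 / 2) \<le> N * w s" using N0 by (rule mult_left_mono)
    moreover have "v y - v s \<le> N / 2" using osc_upper[OF v xy(2) s] N by simp
    ultimately show ?thesis using \<epsilon> by simp
  qed
  have "N * w s + v s - (N * w t + v t) \<le> N + (v x - v y) + \<epsilon>"
    if "s \<in> topspace K" "t \<in> topspace K" for s t
    using up[OF that(1)] low[OF that(2)] by simp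
  moreover have "continuous_map K euclideanreal (\<lambda>s. N * w s + v s)"
    using w v by (intro continuous_map_real_mult continuous_map_add) auto
  ultimately have 1: "osc K (\<lambda>s. N * w s + v s) \<le> N + (v x - v y) + \<epsilon>"
    by (simp add: osc_le_iff)
  have "w s - w t \<le> w x - w y" if "s \<in> topspace K" "t \<in> topspace K" for s t
    using w01[OF that(1)] w01[OF that(2)] wxy by simp
  then have "osc K w = 1" using osc_eqI[OF xy(1,2), of w] wxy by simp
  then show thesis using that[OF w _ _ 1] wxy by simp
qed

end

text \<open>All identities are understood modulo constants, hence the differences of values.\<close>

locale osc_isometry = K: compact_Hausdorff K + L: compact_Hausdorff L
  for K :: "'b topology" and L :: "'a topology" +
  fixes S :: "('b \<Rightarrow> real) \<Rightarrow> 'a \<Rightarrow> real"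
  assumes S_cont: "continuous_map K euclideanreal v \<Longrightarrow> continuous_map L euclideanreal (S v)"
    and S_add: "\<lbrakk>continuous_map K euclideanreal v; continuous_map K euclideanreal w;
        p \<in> topspace L; q \<in> topspace L\<rbrakk>
      \<Longrightarrow> S (\<lambda>x. v x + w x) p - S (\<lambda>x. v x + w x) q = (S v p - S v q) + (S w p - S w q)"
    and S_osc: "continuous_map K euclideanreal v \<Longrightarrow> osc L (S v) = osc K v"
    and S_surj: "continuous_map L euclideanreal u \<Longrightarrow> \<exists>v. continuous_map K euclideanreal v \<and>
      (\<forall>p\<in>topspace L. \<forall>q\<in>topspace L. S v p - S v q = u p - u q)"
begin

section \<open>Consequences of additivity modulo constants\<close>

lemma S_zero: "\<lbrakk>p \<in> topspace L; q \<in> topspace L\<rbrakk> \<Longrightarrow> S (\<lambda>x. 0) p - S (\<lambda>x. 0) q = 0"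
  using S_add[of "\<lambda>x. 0" "\<lambda>x. 0" p q] by simp

lemma S_minus:
  assumes "continuous_map K euclideanreal v" "p \<in> topspace L" "q \<in> topspace L"
  shows "S (\<lambda>x. - v x) p - S (\<lambda>x. - v x) q = - (S v p - S v q)"
  using S_add[OF assms(1) continuous_map_minus[OF assms(1)] assms(2,3)] S_zero[OF assms(2,3)]
  by simp

lemma S_sum:
  assumes "finite F" "\<forall>w\<in>F. continuous_map K euclideanreal w" "p \<in> topspace L" "q \<in> topspace L"
  shows "S (\<lambda>x. \<Sum>w\<in>F. w x) p - S (\<lambda>x. \<Sum>w\<in>F. w x) q = (\<Sum>w\<in>F. S w p - S w q)"
  using assms(1,2)
proof (induction rule: finite_induct)
  case empty
  then show ?case using S_zero[OF assms(3,4)] by simp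
next
  case (insert w F)
  have "continuous_map K euclideanreal (\<lambda>x. \<Sum>w\<in>F. w x)"
    using insert by (intro continuous_map_sum) auto
  then show ?case using insert S_add[OF _ _ assms(3,4), of w "\<lambda>x. \<Sum>w\<in>F. w x"] by simp
qed

text \<open>The factor in the peak argument is a natural number, so additivity supplies all the
  homogeneity that is used.\<close>

lemma S_of_nat:
  assumes "continuous_map K euclideanreal w" "p \<in> topspace L" "q \<in> topspace L"
  shows "S (\<lambda>x. real n * w x) p - S (\<lambda>x. real n * w x) q = real n * (S w p - S w q)"
proof (induction n)
  case 0
  then show ?case using S_zero[OF assms(2,3)] by simp
next
  case (Suc n)
  have "(\<lambda>x. real (Suc n) * w x) = (\<lambda>x. w x + real n * w x)" by (auto simp: algebra_simps)
  moreover have "continuous_map K euclideanreal (\<lambda>x. real n * w x)"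
    using assms(1) by (intro continuous_map_real_mult) auto
  ultimately show ?case
    using Suc S_add[OF assms(1) _ assms(2,3), of "\<lambda>x. real n * w x"] by (simp add: algebra_simps)
qed

text \<open>Functions of oscillation one that rise by one from \<open>y\<close> to \<open>x\<close>
  add up without loss: a sum of finitely many of them has oscillation at least their number. Its
  image attains this oscillation at some \<open>(p, q)\<close>, where every summand contributes at
  most one, so each contributes exactly one. Compactness of the product passes from finite families
  to all of them.\<close>

lemma peak_set_nonempty:
  assumes xy: "x \<in> topspace K" "y \<in> topspace K"
  obtains p q where "p \<in> topspace L" "q \<in> topspace L"
    "\<forall>w. continuous_map K euclideanreal w \<and> osc K w = 1 \<and> w x - w y = 1 \<longrightarrow> S w p - S w q = 1"
proof -
  define F where "F = {w. continuous_map K euclideanreal w \<and> osc K w = 1 \<and> w x - w y = 1}"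
  define P where
    "P w = {z \<in> topspace (prod_topology L L). S w (fst z) - S w (snd z) \<in> {1}}" for w
  let ?top = "topspace (prod_topology L L)"
  have "compact_space (prod_topology L L)"
    using L.compact by (simp add: compact_space_prod_topology)
  moreover have "closedin (prod_topology L L) (P w)" if "w \<in> F" for w
  proof -
    have c: "continuous_map L euclideanreal (S w)" using that by (simp add: F_def S_cont)
    have "continuous_map (prod_topology L L) euclideanreal (\<lambda>z. S w (fst z) - S w (snd z))"
      using continuous_map_compose[OF continuous_map_fst c]
        continuous_map_compose[OF continuous_map_snd c]
      by (intro continuous_map_diff) (simp_all add: o_def)
    then show ?thesis unfolding P_def by (rule closedin_continuous_map_preimage) simp
  qed
  \<comment> \<open>The whole product joins the family so that a point of the intersection lies in
    the space even when \<open>F\<close> is empty, as happens for \<open>x = y\<close>.\<close>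
  moreover have "closedin (prod_topology L L) ?top" by (rule closedin_topspace)
  moreover have "\<Inter>\<G> \<noteq> {}" if "finite \<G>" "\<G> \<subseteq> insert ?top (P ` F)" for \<G>
  proof -
    have "finite (\<G> - {?top})" "\<G> - {?top} \<subseteq> P ` F" using that by auto
    then obtain G where G: "G \<subseteq> F" "finite G" "\<G> - {?top} = P ` G"
      by (meson finite_subset_image)
    have cont: "\<forall>w\<in>G. continuous_map K euclideanreal w" using G(1) by (auto simp: F_def)
    then have c: "continuous_map K euclideanreal (\<lambda>s. \<Sum>w\<in>G. w s)"
      using G(2) by (intro continuous_map_sum) auto
    obtain p q where pq: "p \<in> topspace L" "q \<in> topspace L"
      "osc L (S (\<lambda>s. \<Sum>w\<in>G. w s)) = S (\<lambda>s. \<Sum>w\<in>G. w s) p - S (\<lambda>s. \<Sum>w\<in>G. w s) q"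
      by (rule L.osc_attained[OF S_cont[OF c]])
    have "(\<Sum>w\<in>G. 1 :: real) = (\<Sum>w\<in>G. w x - w y)"
      using G(1) by (intro sum.cong) (auto simp: F_def)
    also have "\<dots> \<le> osc K (\<lambda>s. \<Sum>w\<in>G. w s)"
      using K.osc_upper[OF c xy] by (simp add: sum_subtractf)
    also have "\<dots> = (\<Sum>w\<in>G. S w p - S w q)"
      using pq S_osc[OF c] S_sum[OF G(2) cont pq(1,2)] by simp
    finally have ge: "(\<Sum>w\<in>G. 1 - (S w p - S w q)) \<le> 0" by (simp add: sum_subtractf)
    have le: "0 \<le> 1 - (S w p - S w q)" if "w \<in> G" for w
      using L.osc_upper[OF S_cont pq(1,2), of w] S_osc[of w] that G(1) by (auto simp: F_def)
    have "0 \<le> (\<Sum>w\<in>G. 1 - (S w p - S w q))" by (rule sum_nonneg) (rule le)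
    with ge have "(\<Sum>w\<in>G. 1 - (S w p - S w q)) = 0" by (rule antisym)
    then have all1: "\<forall>w\<in>G. 1 - (S w p - S w q) = 0"
      by (subst (asm) sum_nonneg_eq_0_iff[OF G(2)]) (use le in blast)+
    have "(p, q) \<in> A" if "A \<in> \<G>" for A
    proof (cases "A = ?top")
      case False
      then have "A \<in> P ` G" using that unfolding G(3)[symmetric] by simp
      then obtain w where "w \<in> G" "A = P w" by (rule imageE)
      then show ?thesis using all1 pq by (simp add: P_def)
    qed (use pq in simp)
    then show ?thesis by blast
  qed
  ultimately have "\<Inter>(insert ?top (P ` F)) \<noteq> {}"
    unfolding compact_space_fip by (elim allE[of _ "insert ?top (P ` F)"]) auto
  then obtain z where "z \<in> ?top" "\<forall>w\<in>F. z \<in> P w" by blast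
  then show thesis using that[of "fst z" "snd z"] by (auto simp: P_def F_def)
qed

text \<open>For \<open>w\<close> in the peak face of \<open>(x, y)\<close> and large \<open>N\<close>, the infimum of
  \<open>osc (N w + v) - N\<close> is \<open>v x - v y\<close>, whereas \<open>osc (S (N w + v)) - N\<close> is at least
  \<open>S v p - S v q\<close>.\<close>

lemma point_evaluations:
  assumes xy: "x \<in> topspace K" "y \<in> topspace K" "x \<noteq> y"
  obtains p q where "p \<in> topspace L" "q \<in> topspace L"
    "\<forall>v. continuous_map K euclideanreal v \<longrightarrow> v x - v y = S v p - S v q"
proof -
  obtain p q where pq: "p \<in> topspace L" "q \<in> topspace L" and 1:
    "\<forall>w. continuous_map K euclideanreal w \<and> osc K w = 1 \<and> w x - w y = 1 \<longrightarrow> S w p - S w q = 1"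
    by (rule peak_set_nonempty[OF xy(1,2)])
  have le: "S v p - S v q \<le> v x - v y" if v: "continuous_map K euclideanreal v" for v
  proof (rule field_le_epsilon)
    fix \<epsilon> :: real assume \<epsilon>: "0 < \<epsilon>"
    obtain N :: nat where N: "2 * osc K v \<le> real N" using real_arch_simple by blast
    obtain w where w: "continuous_map K euclideanreal w" "osc K w = 1" "w x - w y = 1"
      "osc K (\<lambda>s. real N * w s + v s) \<le> real N + (v x - v y) + \<epsilon>"
      by (rule K.peak_function[OF v xy \<epsilon> N])
    have Nw: "continuous_map K euclideanreal (\<lambda>s. real N * w s)"
      using w(1) by (intro continuous_map_real_mult) auto
    then have c: "continuous_map K euclideanreal (\<lambda>s. real N * w s + v s)"
      using v by (rule continuous_map_add)
    have "real N + (S v p - S v q) = real N * (S w p - S w q) + (S v p - S v q)"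
      using 1 w by simp
    also have "\<dots> = S (\<lambda>s. real N * w s + v s) p - S (\<lambda>s. real N * w s + v s) q"
      using S_add[OF Nw v pq] S_of_nat[OF w(1) pq] by simp
    also have "\<dots> \<le> osc K (\<lambda>s. real N * w s + v s)"
      using L.osc_upper[OF S_cont[OF c] pq] S_osc[OF c] by simp
    finally show "S v p - S v q \<le> v x - v y + \<epsilon>" using w(4) by simp
  qed
  \<comment> \<open>Applying the inequality to the negative of \<open>v\<close> reverses it.\<close>
  have "v x - v y = S v p - S v q" if v: "continuous_map K euclideanreal v" for v
    using le[OF v] le[OF continuous_map_minus[OF v]] S_minus[OF v pq] by simp
  then show thesis using that[OF pq] by blast
qed

section \<open>Comparing the point pairs that belong to different pairs\<close>

lemma separating_preimage:
  assumes "a \<in> topspace L" "finite A" "a \<notin> A" "A \<subseteq> topspace L"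
  obtains v u where "continuous_map K euclideanreal v" "u a = 1" "\<forall>b\<in>A. u b = 0"
    "\<forall>p\<in>topspace L. \<forall>q\<in>topspace L. S v p - S v q = u p - u q"
proof -
  obtain u where "continuous_map L euclideanreal u" "u a = 1" "\<forall>b\<in>A. u b = 0"
    by (rule L.finite_indicator[OF assms])
  then show thesis using S_surj[of u] that by blast
qed

text \<open>Dually, the adjoint of \<open>S\<close> sends the difference of the point masses at
  \<open>p\<close> and \<open>q\<close> to that of the point masses at \<open>x\<close> and
  \<open>y\<close>.\<close>

definition corr :: "'b \<Rightarrow> 'b \<Rightarrow> 'a \<Rightarrow> 'a \<Rightarrow> bool" where
  "corr x y p q \<longleftrightarrow> p \<in> topspace L \<and> q \<in> topspace L \<and>
    (\<forall>v. continuous_map K euclideanreal v \<longrightarrow> v x - v y = S v p - S v q)"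

lemma corr_distinct:
  assumes "corr x y p q" "x \<in> topspace K" "y \<in> topspace K" "x \<noteq> y"
  shows "p \<noteq> q"
proof
  assume "p = q"
  obtain v where "continuous_map K euclideanreal v" "v x = 1" "\<forall>z\<in>{y}. v z = 0"
    using K.finite_indicator[of x "{y}"] assms by auto
  then show False using assms(1) \<open>p = q\<close> by (auto simp: corr_def)
qed

text \<open>The differences for \<open>(x, y)\<close> and \<open>(y, z)\<close> add up to that for
  \<open>(x, z)\<close>. So the point masses with signs \<open>a - b + e - f\<close> must reduce to
  \<open>c - d\<close>, and this cancellation cannot happen unless \<open>a = c\<close> or
  \<open>b = d\<close>. Both equalities together would identify the functionals of
  \<open>(x, y)\<close> and \<open>(x, z)\<close>, although continuous functions separate
  \<open>y\<close> from \<open>z\<close>.\<close>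

lemma corr_share:
  assumes xyz: "x \<in> topspace K" "y \<in> topspace K" "z \<in> topspace K"
    and ne: "x \<noteq> y" "x \<noteq> z" "y \<noteq> z"
    and c: "corr x y a b" "corr x z c d"
  shows "(a = c) \<noteq> (b = d)"
proof -
  obtain e f where ef: "corr y z e f"
    using point_evaluations[OF xyz(2,3) ne(3)] unfolding corr_def by metis
  have top: "{a, b, c, d, e, f} \<subseteq> topspace L" using c ef by (auto simp: corr_def)
  have ab: "a \<noteq> b" and cd: "c \<noteq> d" and "e \<noteq> f"
    using corr_distinct c ef xyz ne by blast+
  have "\<not> (a = c \<and> b = d)"
  proof
    assume eq: "a = c \<and> b = d"
    obtain v where v: "continuous_map K euclideanreal v" "v y = 1" "\<forall>s\<in>{z}. v s = 0"
      using K.finite_indicator[of y "{z}"] xyz ne by auto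
    have "v x - v y = v x - v z" using c eq v(1) by (simp add: corr_def)
    then show False using v by simp
  qed
  moreover have "a = c \<or> b = d"
  proof (rule ccontr)
    assume "\<not> (a = c \<or> b = d)"
    then have n: "a \<noteq> c" "b \<noteq> d" by auto
    have eq: "(u a - u b) + (u e - u f) = u c - u d"
      if v: "continuous_map K euclideanreal v" and
        u: "\<forall>p\<in>topspace L. \<forall>q\<in>topspace L. S v p - S v q = u p - u q" for v u
    proof -
      have "v x - v y = u a - u b" "v x - v z = u c - u d" "v y - v z = u e - u f"
        using c ef u v by (auto simp: corr_def)
      then show ?thesis by simp
    qed
    \<comment> \<open>This reads off the coefficient at \<open>a\<close>: the right-hand side has no
      positive mass there, so \<open>f\<close> must cancel it.\<close>
    obtain v u where vu: "continuous_map K euclideanreal v" "u a = 1"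
      "\<forall>s\<in>{b, c, d, e, f} - {a}. u s = 0"
      "\<forall>p\<in>topspace L. \<forall>q\<in>topspace L. S v p - S v q = u p - u q"
      by (rule separating_preimage[of a "{b, c, d, e, f} - {a}"]) (use top in auto)
    have u: "u s = (if s = a then 1 else 0)" if "s \<in> {b, c, d, e, f}" for s
      using vu that by auto
    have "u b = 0" "u c = 0" "u d = (if d = a then 1 else 0)"
      "u e = (if e = a then 1 else 0)" "u f = (if f = a then 1 else 0)"
      using u[of b] u[of c] u[of d] u[of e] u[of f] ab n by auto
    then have fa: "f = a" using eq[OF vu(1,4)] vu(2) \<open>e \<noteq> f\<close> by (auto split: if_splits)
    \<comment> \<open>Likewise at \<open>b\<close>: the negative mass there can be cancelled by
      \<open>e\<close> alone.\<close>
    obtain v u where vu: "continuous_map K euclideanreal v" "u b = 1"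
      "\<forall>s\<in>{a, c, d, e, f} - {b}. u s = 0"
      "\<forall>p\<in>topspace L. \<forall>q\<in>topspace L. S v p - S v q = u p - u q"
      by (rule separating_preimage[of b "{a, c, d, e, f} - {b}"]) (use top in auto)
    have u: "u s = (if s = b then 1 else 0)" if "s \<in> {a, c, d, e, f}" for s
      using vu that by auto
    have "u a = 0" "u d = 0" "u c = (if c = b then 1 else 0)"
      "u e = (if e = b then 1 else 0)" "u f = 0"
      using u[of a] u[of c] u[of d] u[of e] u[of f] ab n fa by auto
    then have eb: "e = b" using eq[OF vu(1,4)] vu(2) by (auto split: if_splits)
    \<comment> \<open>With \<open>f = a\<close> and \<open>e = b\<close> the left-hand side vanishes
      for every function, whereas this one makes the right-hand side equal to one.\<close>
    obtain v u where vu: "continuous_map K euclideanreal v" "u c = 1"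
      "\<forall>s\<in>{d}. u s = 0"
      "\<forall>p\<in>topspace L. \<forall>q\<in>topspace L. S v p - S v q = u p - u q"
      by (rule separating_preimage[of c "{d}"]) (use top cd in auto)
    then show False using eq[OF vu(1,4)] fa eb by simp
  qed
  ultimately show ?thesis by blast
qed

text \<open>With \<open>x0\<close> fixed, the pairs belonging to different \<open>y\<close> agree in
  exactly one coordinate. Were neither coordinate constant, some \<open>s\<close> would differ from
  \<open>y\<close> in the first coordinate only and some \<open>t\<close> in the second only; then
  \<open>s\<close> and \<open>t\<close> would agree in neither. A constant first coordinate gives
  the sign 1, a constant second coordinate the sign -1.\<close>

lemma weighted_composition:
  obtains \<epsilon> :: int and \<theta> where "\<epsilon> \<in> {-1, 1}" "\<theta> \<in> topspace K \<rightarrow> topspace L"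
    "\<forall>v x y. continuous_map K euclideanreal v \<longrightarrow> x \<in> topspace K \<longrightarrow> y \<in> topspace K \<longrightarrow>
      v x - v y = \<epsilon> * (S v (\<theta> x) - S v (\<theta> y))"
proof -
  obtain x0 where x0: "x0 \<in> topspace K" using K.nonempty by blast
  obtain l0 where l0: "l0 \<in> topspace L" using L.nonempty by blast
  have "\<forall>y. \<exists>p q. y \<in> topspace K - {x0} \<longrightarrow> corr x0 y p q"
    using point_evaluations[OF x0] unfolding corr_def by (metis DiffD1 DiffD2 singletonI)
  then obtain p q where pq: "\<And>y. y \<in> topspace K - {x0} \<Longrightarrow> corr x0 y (p y) (q y)"
    by metis
  have corr: "corr x0 y (p y) (q y)" if "y \<in> topspace K" "y \<noteq> x0" for y using pq that by simp
  have share: "(p y = p z) \<noteq> (q y = q z)"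
    if "y \<in> topspace K" "z \<in> topspace K" "y \<noteq> x0" "z \<noteq> x0" "y \<noteq> z" for y z
    using corr_share[OF x0 that(1,2) _ _ that(5) corr[OF that(1,3)] corr[OF that(2,4)]] that by blast
  have dist: "p y \<noteq> q y" if "y \<in> topspace K" "y \<noteq> x0" for y
    using corr_distinct[OF corr[OF that] x0 that(1)] that by blast
  have "(\<exists>a\<in>topspace L. \<forall>y\<in>topspace K - {x0}. p y = a) \<or>
      (\<exists>b\<in>topspace L. \<forall>y\<in>topspace K - {x0}. q y = b)"
  proof (rule ccontr)
    assume neg: "\<not> ?thesis"
    \<comment> \<open>If \<open>x0\<close> were the only point, \<open>l0\<close> would be a
      constant value vacuously; so the negation provides a second point.\<close>
    then obtain y where y: "y \<in> topspace K" "y \<noteq> x0" using l0 by blast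
    have ty: "p y \<in> topspace L" "q y \<in> topspace L" using corr[OF y] by (auto simp: corr_def)
    obtain s where s: "s \<in> topspace K" "s \<noteq> x0" "p s \<noteq> p y" using neg ty(1) by blast
    obtain t where t: "t \<in> topspace K" "t \<noteq> x0" "q t \<noteq> q y" using neg ty(2) by blast
    have "q s = q y" using share[OF y(1) s(1) y(2) s(2)] s(3) by metis
    moreover have "p t = p y" using share[OF y(1) t(1) y(2) t(2)] t(3) by metis
    ultimately show False using share[OF s(1) t(1) s(2) t(2)] s(3) t(3) by metis
  qed
  then show thesis
  proof
    assume "\<exists>a\<in>topspace L. \<forall>y\<in>topspace K - {x0}. p y = a"
    then obtain a where a: "a \<in> topspace L" "\<And>y. y \<in> topspace K - {x0} \<Longrightarrow> p y = a" by blast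
    \<comment> \<open>The common coordinate is the image of \<open>x0\<close>, and the varying one
      is the image of \<open>y\<close>.\<close>
    let ?\<theta> = "\<lambda>y. if y = x0 then a else q y"
    have 1: "v x0 - v y = S v a - S v (?\<theta> y)"
      if "continuous_map K euclideanreal v" "y \<in> topspace K" for v y
      using corr[of y] a(2)[of y] that by (auto simp: corr_def)
    have "?\<theta> \<in> topspace K \<rightarrow> topspace L" using a(1) corr by (auto simp: corr_def)
    moreover have "v x - v y = real_of_int 1 * (S v (?\<theta> x) - S v (?\<theta> y))"
      if "continuous_map K euclideanreal v" "x \<in> topspace K" "y \<in> topspace K" for v x y
      using 1[OF that(1,2)] 1[OF that(1,3)] by simp
    ultimately show thesis using that[of 1 ?\<theta>] by blast
  next
    assume "\<exists>b\<in>topspace L. \<forall>y\<in>topspace K - {x0}. q y = b"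
    then obtain b where b: "b \<in> topspace L" "\<And>y. y \<in> topspace K - {x0} \<Longrightarrow> q y = b" by blast
    let ?\<theta> = "\<lambda>y. if y = x0 then b else p y"
    have 1: "v x0 - v y = S v (?\<theta> y) - S v b"
      if "continuous_map K euclideanreal v" "y \<in> topspace K" for v y
      using corr[of y] b(2)[of y] that by (auto simp: corr_def)
    have "?\<theta> \<in> topspace K \<rightarrow> topspace L" using b(1) corr by (auto simp: corr_def)
    moreover have "v x - v y = real_of_int (-1) * (S v (?\<theta> x) - S v (?\<theta> y))"
      if "continuous_map K euclideanreal v" "x \<in> topspace K" "y \<in> topspace K" for v x y
      using 1[OF that(1,2)] 1[OF that(1,3)] by simp
    ultimately show thesis using that[of "-1" ?\<theta>] by blast
  qed
qed

text \<open>The formula determines \<open>S v\<close> on the image of \<open>\<theta>\<close> up to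
  a constant, and surjectivity of \<open>S\<close> turns this into statements about arbitrary
  continuous functions on \<open>L\<close>. Since \<open>K\<close> is compact and \<open>L\<close>
  Hausdorff, a continuous bijection is all that has to be found.\<close>

theorem homeomorphic_representation:
  obtains \<epsilon> :: int and \<theta> where "\<epsilon> \<in> {-1, 1}" "homeomorphic_map K L \<theta>"
    "\<forall>v x y. continuous_map K euclideanreal v \<longrightarrow> x \<in> topspace K \<longrightarrow> y \<in> topspace K \<longrightarrow>
      v x - v y = \<epsilon> * (S v (\<theta> x) - S v (\<theta> y))"
proof -
  obtain \<epsilon> :: int and \<theta> where \<epsilon>: "\<epsilon> \<in> {-1, 1}" and \<theta>: "\<theta> \<in> topspace K \<rightarrow> topspace L" and
    all: "\<forall>v x y. continuous_map K euclideanreal v \<longrightarrow> x \<in> topspace K \<longrightarrow> y \<in> topspace K \<longrightarrow>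
      v x - v y = \<epsilon> * (S v (\<theta> x) - S v (\<theta> y))"
    by (rule weighted_composition)
  have eq: "v x - v y = \<epsilon> * (S v (\<theta> x) - S v (\<theta> y))"
    if "continuous_map K euclideanreal v" "x \<in> topspace K" "y \<in> topspace K" for v x y
    using all that by blast
  have \<theta>L: "\<theta> x \<in> topspace L" if "x \<in> topspace K" for x using \<theta> that by auto
  obtain x0 where x0: "x0 \<in> topspace K" using K.nonempty by blast
  \<comment> \<open>Solving the formula for \<open>u\<close> composed with \<open>\<theta>\<close>,
    where \<open>\<epsilon>\<close> is its own reciprocal, leaves an affine expression in the
    continuous \<open>v\<close>. Bump functions then detect the topology of
    \<open>L\<close>.\<close>
  have cont_u: "continuous_map K euclideanreal (\<lambda>x. u (\<theta> x))"
    if u: "continuous_map L euclideanreal u" for u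
  proof -
    obtain v where v: "continuous_map K euclideanreal v"
      "\<forall>p\<in>topspace L. \<forall>q\<in>topspace L. S v p - S v q = u p - u q" using S_surj[OF u] by blast
    have "u (\<theta> x) = u (\<theta> x0) + \<epsilon> * (v x - v x0)" if "x \<in> topspace K" for x
      using eq[OF v(1) that x0] v(2) \<theta>L[OF that] \<theta>L[OF x0] \<epsilon> by auto
    moreover have "continuous_map K euclideanreal (\<lambda>x. u (\<theta> x0) + \<epsilon> * (v x - v x0))"
      using v(1) by (intro continuous_map_add continuous_map_real_mult continuous_map_diff) auto
    ultimately show ?thesis using continuous_map_eq[of K euclideanreal _ "\<lambda>x. u (\<theta> x)"] by simp
  qed
  have cont: "continuous_map K L \<theta>"
    unfolding continuous_map
  proof (intro conjI allI impI)
    show "\<theta> ` topspace K \<subseteq> topspace L" using \<theta> by auto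
    fix U assume U: "openin L U"
    show "openin K {x \<in> topspace K. \<theta> x \<in> U}"
    proof (subst openin_subopen, intro ballI)
      fix x assume "x \<in> {x \<in> topspace K. \<theta> x \<in> U}"
      then have x: "x \<in> topspace K" "\<theta> x \<in> U" by auto
      obtain p where p: "continuous_map L euclideanreal p" "p (\<theta> x) = 1"
        "\<forall>y\<in>topspace L - U. p y = 0"
        by (rule L.bump[OF U x(2)])
      have "openin K {y \<in> topspace K. p (\<theta> y) \<in> {0<..}}"
        by (rule openin_continuous_map_preimage[OF cont_u[OF p(1)]]) simp
      moreover have "{y \<in> topspace K. p (\<theta> y) \<in> {0<..}} \<subseteq> {x \<in> topspace K. \<theta> x \<in> U}"
        using p(3) \<theta>L by force
      ultimately show "\<exists>T. openin K T \<and> x \<in> T \<and> T \<subseteq> {x \<in> topspace K. \<theta> x \<in> U}"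
        using x p(2) by (intro exI[of _ "{y \<in> topspace K. p (\<theta> y) \<in> {0<..}}"]) auto
    qed
  qed
  have inj: "inj_on \<theta> (topspace K)"
  proof (rule inj_onI, rule ccontr)
    fix x y assume xy: "x \<in> topspace K" "y \<in> topspace K" "\<theta> x = \<theta> y" "x \<noteq> y"
    obtain v where v: "continuous_map K euclideanreal v" "v x = 1" "\<forall>s\<in>{y}. v s = 0"
      using K.finite_indicator[of x "{y}"] xy by auto
    then show False using eq[OF v(1) xy(1,2)] xy(3) by simp
  qed
  have surj: "\<theta> ` topspace K = topspace L"
  proof (rule ccontr)
    assume "\<theta> ` topspace K \<noteq> topspace L"
    then obtain l where l: "l \<in> topspace L" "l \<notin> \<theta> ` topspace K" using \<theta> by blast
    have "compactin L (\<theta> ` topspace K)"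
      using image_compactin[OF _ cont] K.compact by (simp add: compact_space_def)
    then have "openin L (topspace L - \<theta> ` topspace K)"
      using L.Hausdorff compactin_imp_closedin by blast
    moreover have "l \<in> topspace L - \<theta> ` topspace K" using l by simp
    ultimately obtain u where u: "continuous_map L euclideanreal u" "u l = 1"
      "\<forall>y\<in>topspace L - (topspace L - \<theta> ` topspace K). u y = 0"
      by (rule L.bump)
    have u0: "u (\<theta> x) = 0" if "x \<in> topspace K" for x using u(3) \<theta>L[OF that] that by blast
    obtain v where v: "continuous_map K euclideanreal v"
      "\<forall>p\<in>topspace L. \<forall>q\<in>topspace L. S v p - S v q = u p - u q" using S_surj[OF u(1)] by blast
    \<comment> \<open>A function supported off the image of \<open>\<theta>\<close> comes from a
      constant \<open>v\<close>. As \<open>S\<close> preserves oscillation, its image is constant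
      too, which contradicts the value 1 at \<open>l\<close>.\<close>
    have "v x = v y" if "x \<in> topspace K" "y \<in> topspace K" for x y
      using eq[OF v(1) that] v(2) \<theta>L[OF that(1)] \<theta>L[OF that(2)] u0 that by auto
    then have "osc K v = 0" using K.osc_eq_0_iff[OF v(1)] by blast
    then have "osc L (S v) = 0" using S_osc[OF v(1)] by simp
    then have "S v l = S v (\<theta> x0)"
      using L.osc_eq_0_iff[OF S_cont[OF v(1)]] l(1) \<theta>L[OF x0] by blast
    then show False using v(2) l(1) \<theta>L[OF x0] u(2) u0[OF x0] by force
  qed
  have "homeomorphic_map K L \<theta>"
    by (rule continuous_imp_homeomorphic_map)
      (use K.compact L.Hausdorff cont surj inj in auto)
  then show thesis using that[OF \<epsilon>] all by blast
qed

end

section \<open>Hilbert's metric as the oscillation of a logarithm\<close>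

lemma powi_pm1: "\<epsilon> \<in> {-1, 1} \<Longrightarrow> 0 < (a::real) \<Longrightarrow> a powi \<epsilon> = exp (\<epsilon> * ln a)"
  by (auto simp: exp_minus power_int_minus)

lemma finite_Borel_measure_space:
  assumes "finite_Borel_measure K M"
  shows "space M = topspace K"
proof -
  have "space M = space (sigma (topspace K) {U. openin K U})"
    using assms by (intro sets_eq_imp_space_eq) (simp add: finite_Borel_measure_def)
  then show ?thesis using openin_subset[of K] by (subst (asm) space_measure_of) auto
qed

locale measured_compact = compact_Hausdorff K for K :: "'a topology" +
  fixes M :: "'a measure"
  assumes borel: "finite_Borel_measure K M" and pos: "strictly_positive K M"
begin

lemma space_M: "space M = topspace K"
  using borel by (rule finite_Borel_measure_space)

lemma integrable_continuous:
  assumes u: "continuous_map K euclideanreal u"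
  shows "integrable M u"
proof -
  interpret finite_measure M using borel by (simp add: finite_Borel_measure_def)
  have "u \<in> borel_measurable M"
  proof (rule borel_measurableI)
    fix S :: "real set" assume "open S"
    then have "openin K {x \<in> topspace K. u x \<in> S}"
      by (intro openin_continuous_map_preimage[OF u]) simp
    moreover have "u -` S \<inter> space M = {x \<in> topspace K. u x \<in> S}" by (auto simp: space_M)
    ultimately have "u -` S \<inter> space M \<in> sets (sigma (topspace K) {U. openin K U})"
      using openin_subset[of K] by (subst sets_measure_of) auto
    then show "u -` S \<inter> space M \<in> sets M" using borel by (simp add: finite_Borel_measure_def)
  qed
  moreover obtain a where "\<forall>y\<in>topspace K. \<bar>u y\<bar> \<le> \<bar>u a\<bar>"
    using attains_sup[OF continuous_map_real_abs[OF u]] by metis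
  ultimately show ?thesis
    by (intro integrable_const_bound[where B = "\<bar>u a\<bar>"]) (auto simp: space_M)
qed

lemma restrict_C_space:
  assumes "continuous_map K euclideanreal u"
  shows "restrict u (topspace K) \<in> C_space K"
  using continuous_map_eq[OF assms, of "restrict u (topspace K)"] by (simp add: C_space_def)

lemma integral_cong_K:
  "(\<And>x. x \<in> topspace K \<Longrightarrow> u x = v x) \<Longrightarrow> (LINT x|M. u x) = (LINT x|M. v x)"
  by (intro Bochner_Integration.integral_cong) (auto simp: space_M)

lemma integral_pos:
  assumes u: "continuous_map K euclideanreal u" and "\<And>x. x \<in> topspace K \<Longrightarrow> 0 \<le> u x"
    and "x \<in> topspace K" "u x \<noteq> 0"
  shows "0 < (LINT x|M. u x)"
proof -
  have "\<exists>x\<in>topspace K. restrict u (topspace K) x \<noteq> 0"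
    "\<forall>x\<in>topspace K. 0 \<le> restrict u (topspace K) x" using assms by auto
  then have "0 < (LINT x|M. restrict u (topspace K) x)"
    using pos restrict_C_space[OF u] unfolding strictly_positive_def by blast
  also have "\<dots> = (LINT x|M. u x)" by (rule integral_cong_K) simp
  finally show ?thesis .
qed

lemma integral_exp_pos:
  assumes "continuous_map K euclideanreal u"
  shows "0 < (LINT x|M. exp (u x))"
proof -
  obtain x where "x \<in> topspace K" using nonempty by blast
  then show ?thesis using integral_pos[OF continuous_map_real_exp[OF assms], of x] by simp
qed

section \<open>Logarithmic coordinates on \<open>Delta K M\<close>\<close>

lemma Delta_D:
  assumes "f \<in> Delta K M"
  shows "continuous_map K euclideanreal f" "f \<in> extensional (topspace K)"
    "\<And>x. x \<in> topspace K \<Longrightarrow> 0 < f x" "(LINT x|M. f x) = 1"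
    "continuous_map K euclideanreal (\<lambda>x. ln (f x))"
  using assms continuous_map_real_ln[of K f] by (auto simp: Delta_def C_space_def)

text \<open>The inverse of the logarithmic chart: modulo constants it is a bijection from the
  continuous functions onto \<open>Delta K M\<close>, the integral in the denominator absorbing the
  constant.\<close>

definition softmax :: "('a \<Rightarrow> real) \<Rightarrow> 'a \<Rightarrow> real" where
  "softmax u = (\<lambda>x\<in>topspace K. exp (u x) / (LINT y|M. exp (u y)))"

lemma softmax_Delta:
  assumes u: "continuous_map K euclideanreal u"
  shows "softmax u \<in> Delta K M"
proof -
  have "(LINT x|M. softmax u x) = (LINT x|M. exp (u x) / (LINT y|M. exp (u y)))"
    by (rule integral_cong_K) (simp add: softmax_def)
  also have "\<dots> = 1" using integral_exp_pos[OF u] by simp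
  finally have "(LINT x|M. softmax u x) = 1" .
  moreover have "continuous_map K euclideanreal (\<lambda>x. exp (u x) / (LINT y|M. exp (u y)))"
    using integral_exp_pos[OF u] continuous_map_real_exp[OF u]
    by (intro continuous_map_real_divide) auto
  then have "softmax u \<in> C_space K" unfolding softmax_def by (rule restrict_C_space)
  moreover have "0 < softmax u x" if "x \<in> topspace K" for x
    using integral_exp_pos[OF u] that by (simp add: softmax_def)
  ultimately show ?thesis by (simp add: Delta_def)
qed

lemma ln_softmax:
  "\<lbrakk>continuous_map K euclideanreal u; x \<in> topspace K\<rbrakk>
    \<Longrightarrow> ln (softmax u x) = u x - ln (LINT y|M. exp (u y))"
  using integral_exp_pos[of u] by (simp add: softmax_def ln_div)

lemma softmax_ln:
  assumes f: "f \<in> Delta K M"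
  shows "softmax (\<lambda>x. ln (f x)) = f"
proof -
  have "(LINT y|M. exp (ln (f y))) = (LINT y|M. f y)"
    using Delta_D(3)[OF f] by (intro integral_cong_K) simp
  then show ?thesis
    using Delta_D[OF f] by (intro ext) (auto simp: softmax_def restrict_def extensional_def)
qed

lemma softmax_cong:
  assumes "continuous_map K euclideanreal v"
    and uv: "\<And>x y. \<lbrakk>x \<in> topspace K; y \<in> topspace K\<rbrakk> \<Longrightarrow> u x - u y = v x - v y"
  shows "softmax u = softmax v"
proof -
  obtain a where a: "a \<in> topspace K" using nonempty by blast
  define c where "c = u a - v a"
  have e: "exp (u x) = exp c * exp (v x)" if "x \<in> topspace K" for x
    using uv[OF that a] by (simp add: c_def flip: exp_add)
  then have "(LINT y|M. exp (u y)) = (LINT y|M. exp c * exp (v y))"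
    by (intro integral_cong_K) simp
  then show ?thesis using e by (intro ext) (auto simp: softmax_def restrict_def)
qed

lemma mdist_cfunspace_eqI:
  assumes c: "continuous_map K euclideanreal f" "continuous_map K euclideanreal g"
    and ext: "f \<in> extensional (topspace K)" "g \<in> extensional (topspace K)"
    and a: "a \<in> topspace K" "\<And>x. x \<in> topspace K \<Longrightarrow> \<bar>f x - g x\<bar> \<le> \<bar>f a - g a\<bar>"
  shows "mdist (cfunspace K euclidean_metric) f g = \<bar>f a - g a\<bar>"
proof (rule antisym)
  show "mdist (cfunspace K euclidean_metric) f g \<le> \<bar>f a - g a\<bar>"
    using a by (intro mdist_cfunspace_le) (auto simp: dist_real_def)
  \<comment> \<open>Membership in the function space includes boundedness, which compactness
    provides.\<close>
  have "h \<in> mspace (cfunspace K euclidean_metric)"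
    if "continuous_map K euclideanreal h" "h \<in> extensional (topspace K)" for h
  proof -
    have "compact (h ` topspace K)"
      using image_compactin[OF compact[unfolded compact_space_def] that(1)] by simp
    then have "bounded (h ` topspace K)" by (rule compact_imp_bounded)
    then show ?thesis using that by (simp add: mbounded_iff_bounded)
  qed
  then show "\<bar>f a - g a\<bar> \<le> mdist (cfunspace K euclidean_metric) f g"
    using mdist_cfunspace_imp_mdist_le[OF _ _ order_refl a(1), of f euclidean_metric g] c ext
    by (simp add: dist_real_def)
qed

text \<open>Relative to \<open>f\<close>, the line consists of the functions
  \<open>1 + t * (r - 1)\<close> with \<open>r = g / f\<close>, and positivity first fails where
  \<open>r\<close> is extremal. The cross-ratio of the resulting parameters simplifies to the
  maximum of \<open>r\<close> divided by its minimum, whose logarithm is the oscillation of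
  \<open>ln r\<close>.\<close>

theorem hilbert_dist_eq_osc:
  assumes f: "f \<in> Delta K M" and g: "g \<in> Delta K M"
  shows "hilbert_dist K M f g = osc K (\<lambda>x. ln (f x) - ln (g x))"
proof (cases "f = g")
  case True
  have "osc K (\<lambda>x. ln (g x) - ln (g x)) = 0" by (subst osc_eq_0_iff) auto
  then show ?thesis using True by (simp add: hilbert_dist_def)
next
  case False
  note F = Delta_D[OF f] and G = Delta_D[OF g]
  obtain z where z: "z \<in> topspace K" "f z \<noteq> g z"
    using False extensionalityI[OF F(2) G(2)] by blast
  \<comment> \<open>Two different functions of equal integral cannot be ordered pointwise, by strict
    positivity of the measure. Used in both directions, this puts the minimum of \<open>r\<close>
    below 1 and its maximum above 1.\<close>
  have not_below: "\<exists>x\<in>topspace K. v x < u x"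
    if u: "u \<in> Delta K M" and v: "v \<in> Delta K M" and "u z \<noteq> v z" for u v
  proof (rule ccontr)
    assume "\<not> ?thesis"
    then have "0 < (LINT x|M. v x - u x)"
      using that Delta_D(1)[OF u] Delta_D(1)[OF v] z
      by (intro integral_pos[of _ z] continuous_map_diff) (auto simp: not_less)
    also have "\<dots> = (LINT x|M. v x) - (LINT x|M. u x)"
      using Delta_D(1)[OF u] Delta_D(1)[OF v]
      by (intro Bochner_Integration.integral_diff integrable_continuous)
    finally show False using Delta_D(4)[OF u] Delta_D(4)[OF v] by simp
  qed
  define r where "r x = g x / f x" for x
  have fr: "f x * r x = g x" if "x \<in> topspace K" for x
    using F(3)[OF that] by (simp add: r_def)
  have r: "continuous_map K euclideanreal r"
    unfolding r_def using F(1,3) G(1) by (intro continuous_map_real_divide) force+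
  obtain a where a: "a \<in> topspace K" "\<forall>x\<in>topspace K. r a \<le> r x" by (rule attains_inf[OF r])
  obtain b where b: "b \<in> topspace K" "\<forall>x\<in>topspace K. r x \<le> r b" by (rule attains_sup[OF r])
  have r0: "0 < r x" if "x \<in> topspace K" for x using F(3) G(3) that by (simp add: r_def)
  obtain x where "x \<in> topspace K" "g x < f x" using not_below[OF f g] z by blast
  then have "r x < 1" using F(3) by (simp add: r_def)
  then have ra: "r a < 1" using a(2) \<open>x \<in> topspace K\<close> by force
  obtain y where "y \<in> topspace K" "f y < g y" using not_below[OF g f] z by metis
  then have "1 < r y" using F(3) by (simp add: r_def)
  then have rb: "1 < r b" using b(2) \<open>y \<in> topspace K\<close> by force
  have lp: "line_point K f g t x = f x * (1 + t * (r x - 1))" if "x \<in> topspace K" for t x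
    using fr[OF that] that by (simp add: line_point_def algebra_simps)
  have lpc: "continuous_map K euclideanreal (line_point K f g t)" for t
  proof -
    have "continuous_map K euclideanreal (\<lambda>x. (1 - t) * f x + t * g x)"
      using F(1) G(1) by (intro continuous_map_add continuous_map_real_mult) auto
    then show ?thesis unfolding line_point_def using restrict_C_space by (simp add: C_space_def)
  qed
  have int1: "(LINT x|M. line_point K f g t x) = 1" for t
  proof -
    have "(LINT x|M. line_point K f g t x) = (LINT x|M. (1 - t) * f x + t * g x)"
      by (rule integral_cong_K) (simp add: line_point_def)
    also have "\<dots> = (1 - t) * (LINT x|M. f x) + t * (LINT x|M. g x)"
      using integrable_continuous[OF F(1)] integrable_continuous[OF G(1)] by simp
    finally show ?thesis using F(4) G(4) by simp
  qed
  have ext: "line_point K f g t \<in> extensional (topspace K)" for t by (simp add: line_point_def)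
  \<comment> \<open>These are the zeros in \<open>t\<close> of \<open>1 + t * (r b - 1)\<close> and
    \<open>1 + t * (r a - 1)\<close>: going backwards, positivity is lost first at the maximum
    \<open>b\<close>, going forwards at the minimum \<open>a\<close>.\<close>
  define \<alpha> \<beta> where "\<alpha> = - (1 / (r b - 1))" and "\<beta> = 1 / (1 - r a)"
  have "segment_params K M f g = {\<alpha><..<\<beta>}"
  proof (intro equalityI subsetI)
    fix t assume "t \<in> segment_params K M f g"
    then have "0 < 1 + t * (r x - 1)" if "x \<in> topspace K" for x
      using Delta_D(3)[of "line_point K f g t" x] lp[OF that] F(3)[OF that] that
      by (simp add: segment_params_def zero_less_mult_iff)
    from this[OF a(1)] this[OF b(1)] show "t \<in> {\<alpha><..<\<beta>}"
      using ra rb by (simp add: \<alpha>_def \<beta>_def field_simps)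
  next
    fix t assume t: "t \<in> {\<alpha><..<\<beta>}"
    then have A: "0 < 1 + t * (r a - 1)" and B: "0 < 1 + t * (r b - 1)"
      using ra rb by (simp_all add: \<alpha>_def \<beta>_def field_simps)
    have "0 < 1 + t * (r x - 1)" if x: "x \<in> topspace K" for x
    proof (cases "0 \<le> t")
      case True
      then have "t * (r a - 1) \<le> t * (r x - 1)" using a(2) x by (intro mult_left_mono) auto
      then show ?thesis using A by simp
    next
      case False
      then have "t * (r b - 1) \<le> t * (r x - 1)" using b(2) x by (intro mult_left_mono_neg) auto
      then show ?thesis using B by simp
    qed
    then show "t \<in> segment_params K M f g"
      using lp F(3) lpc ext int1
      by (simp add: segment_params_def Delta_def C_space_def)
  qed
  moreover have \<alpha>0: "\<alpha> < 0" and \<beta>1: "1 < \<beta>"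
    using ra rb r0[OF a(1)] by (simp_all add: \<alpha>_def \<beta>_def)
  ultimately have inf: "Inf (segment_params K M f g) = \<alpha>" "Sup (segment_params K M f g) = \<beta>"
    by simp_all
  obtain c where c: "c \<in> topspace K" "\<forall>x\<in>topspace K. \<bar>f x - g x\<bar> \<le> \<bar>f c - g c\<bar>"
    using attains_sup[OF continuous_map_real_abs[OF continuous_map_diff[OF F(1) G(1)]]] by blast
  define D where "D = \<bar>f c - g c\<bar>"
  have D0: "0 < D" using c(2) z by (force simp: D_def)
  \<comment> \<open>Every length along the line is the parameter difference times the same factor
    \<open>D\<close>, which cancels in the cross-ratio.\<close>
  have len: "mdist (cfunspace K euclidean_metric) (line_point K f g t) (line_point K f g s)
      = \<bar>s - t\<bar> * D" for s t
  proof -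
    have eq: "\<bar>line_point K f g t x - line_point K f g s x\<bar> = \<bar>s - t\<bar> * \<bar>f x - g x\<bar>"
      if "x \<in> topspace K" for x
      using that by (simp add: line_point_def algebra_simps flip: abs_mult)
    show ?thesis
      using mdist_cfunspace_eqI[OF lpc lpc ext ext c(1), of t s] eq c by (simp add: D_def mult_left_mono)
  qed
  have l0: "line_point K f g 0 = f" and l1: "line_point K f g 1 = g"
    using F(2) G(2) by (auto simp: line_point_def restrict_def extensional_def)
  have "hilbert_dist K M f g = ln (((1 - \<alpha>) * D / (- \<alpha> * D)) * (\<beta> * D / ((\<beta> - 1) * D)))"
    using False len[of \<alpha> 1] len[of \<alpha> 0] len[of \<beta> 0] len[of \<beta> 1] \<alpha>0 \<beta>1
    unfolding hilbert_dist_def inf l0 l1 by (simp add: Let_def)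
  also have "\<dots> = ln (((1 - \<alpha>) / (- \<alpha>)) * (\<beta> / (\<beta> - 1)))" using D0 by simp
  also have "(1 - \<alpha>) / (- \<alpha>) = r b" using rb by (simp add: \<alpha>_def field_simps)
  also have "\<beta> / (\<beta> - 1) = 1 / r a" using ra r0[OF a(1)] by (simp add: \<beta>_def field_simps)
  also have "ln (r b * (1 / r a)) = ln (r b) - ln (r a)"
    using r0[OF a(1)] r0[OF b(1)] by (simp add: ln_div)
  also have "\<dots> = osc K (\<lambda>x. ln (g x) - ln (f x))"
  proof -
    have lr: "ln (r x) = ln (g x) - ln (f x)" if "x \<in> topspace K" for x
      using F(3)[OF that] G(3)[OF that] by (simp add: r_def ln_div)
    have "ln (r s) - ln (r t) \<le> ln (r b) - ln (r a)" if "s \<in> topspace K" "t \<in> topspace K" for s t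
      using a b that r0 by (intro diff_mono) simp_all
    then have "osc K (\<lambda>x. ln (g x) - ln (f x)) = (ln (g b) - ln (f b)) - (ln (g a) - ln (f a))"
      using a(1) b(1) lr by (intro osc_eqI) simp_all
    then show ?thesis using a(1) b(1) lr by simp
  qed
  also have "\<dots> = osc K (\<lambda>x. ln (f x) - ln (g x))" by (rule osc_diff_commute[OF G(5) F(5)])
  finally show ?thesis .
qed

lemma osc_ln_softmax:
  assumes "continuous_map K euclideanreal u" "continuous_map K euclideanreal v"
  shows "osc K (\<lambda>x. ln (softmax u x) - ln (softmax v x)) = osc K (\<lambda>x. u x - v x)"
proof (rule osc_cong[symmetric])
  show "continuous_map K euclideanreal (\<lambda>x. u x - v x)" using assms by (rule continuous_map_diff)
qed (simp add: ln_softmax assms)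

lemma hilbert_dist_softmax:
  assumes "continuous_map K euclideanreal u" "continuous_map K euclideanreal v"
  shows "hilbert_dist K M (softmax u) (softmax v) = osc K (\<lambda>x. u x - v x)"
  using assms by (simp add: hilbert_dist_eq_osc softmax_Delta osc_ln_softmax)


text \<open>The distance function is cut off outside the domain because
  \<^locale>\<open>Metric_space\<close> asks for symmetry on the whole type.\<close>

definition hdist :: "('a \<Rightarrow> real) \<Rightarrow> ('a \<Rightarrow> real) \<Rightarrow> real" where
  "hdist f g = (if f \<in> Delta K M \<and> g \<in> Delta K M then hilbert_dist K M f g else 0)"

lemma hdist_softmax:
  assumes "continuous_map K euclideanreal u" "continuous_map K euclideanreal v"
  shows "hdist (softmax u) (softmax v) = osc K (\<lambda>x. u x - v x)"
  using assms by (simp add: hdist_def hilbert_dist_softmax softmax_Delta)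

lemma hdist_eq_osc:
  "\<lbrakk>f \<in> Delta K M; g \<in> Delta K M\<rbrakk> \<Longrightarrow> hdist f g = osc K (\<lambda>x. ln (f x) - ln (g x))"
  by (simp add: hdist_def hilbert_dist_eq_osc)

lemma cont_ln_diff:
  "\<lbrakk>f \<in> Delta K M; g \<in> Delta K M\<rbrakk> \<Longrightarrow> continuous_map K euclideanreal (\<lambda>x. ln (f x) - ln (g x))"
  by (intro continuous_map_diff Delta_D(5))

text \<open>Definiteness is where the normalisation enters: zero oscillation makes the two functions
  proportional, and both have integral one.\<close>

lemma Metric_space_hdist: "Metric_space (Delta K M) hdist"
proof
  show "0 \<le> hdist f g" for f g
    using osc_nonneg[OF cont_ln_diff]
    by (cases "f \<in> Delta K M \<and> g \<in> Delta K M") (auto simp: hdist_eq_osc, auto simp: hdist_def)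
  show "hdist f g = hdist g f" for f g
  proof (cases "f \<in> Delta K M \<and> g \<in> Delta K M")
    case True
    then show ?thesis using osc_diff_commute[OF Delta_D(5) Delta_D(5), of f g] by (simp add: hdist_eq_osc)
  qed (auto simp: hdist_def)
  show "hdist f g = 0 \<longleftrightarrow> f = g" if fg: "f \<in> Delta K M" "g \<in> Delta K M" for f g
  proof
    assume "hdist f g = 0"
    then have "\<forall>x\<in>topspace K. \<forall>y\<in>topspace K. ln (f x) - ln (g x) = ln (f y) - ln (g y)"
      unfolding hdist_eq_osc[OF fg] osc_eq_0_iff[OF cont_ln_diff[OF fg]] .
    then have eq: "ln (f x) - ln (g x) = ln (f y) - ln (g y)"
      if "x \<in> topspace K" "y \<in> topspace K" for x y
      using that by blast
    have "ln (f x) - ln (f y) = ln (g x) - ln (g y)"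
      if "x \<in> topspace K" "y \<in> topspace K" for x y
      using eq[OF that] by linarith
    then have "softmax (\<lambda>x. ln (f x)) = softmax (\<lambda>x. ln (g x))"
      using Delta_D(5)[OF fg(2)] by (intro softmax_cong) blast+
    then show "f = g" using fg by (simp add: softmax_ln)
  qed (simp add: hdist_def hilbert_dist_def)
  show "hdist f h \<le> hdist f g + hdist g h"
    if "f \<in> Delta K M" "g \<in> Delta K M" "h \<in> Delta K M" for f g h
    using osc_triangle[OF cont_ln_diff[OF that(1,2)] cont_ln_diff[OF that(2,3)]] that
    by (simp add: hdist_eq_osc)
qed

section \<open>Point reflections and midpoints\<close>

definition reflection :: "('a \<Rightarrow> real) \<Rightarrow> ('a \<Rightarrow> real) \<Rightarrow> 'a \<Rightarrow> real" where
  "reflection m f = softmax (\<lambda>x. 2 * ln (m x) - ln (f x))"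

lemma cont_reflection:
  assumes "m \<in> Delta K M" "f \<in> Delta K M"
  shows "continuous_map K euclideanreal (\<lambda>x. 2 * ln (m x) - ln (f x))"
  using assms by (intro continuous_map_diff continuous_map_real_mult) (auto simp: Delta_D)

lemma reflection_Delta: "\<lbrakk>m \<in> Delta K M; f \<in> Delta K M\<rbrakk> \<Longrightarrow> reflection m f \<in> Delta K M"
  unfolding reflection_def by (intro softmax_Delta cont_reflection)

lemma reflection_involution:
  assumes "m \<in> Delta K M" "f \<in> Delta K M"
  shows "reflection m (reflection m f) = f"
proof -
  have "softmax (\<lambda>x. 2 * ln (m x) - ln (softmax (\<lambda>x. 2 * ln (m x) - ln (f x)) x))
      = softmax (\<lambda>x. ln (f x))"
    using assms by (intro softmax_cong) (auto simp: Delta_D ln_softmax cont_reflection)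
  then show ?thesis using assms by (simp add: reflection_def softmax_ln)
qed

lemma reflection_isometry:
  assumes "m \<in> Delta K M" "f \<in> Delta K M" "g \<in> Delta K M"
  shows "hdist (reflection m f) (reflection m g) = hdist f g"
  using assms osc_diff_commute[OF Delta_D(5) Delta_D(5), of g f]
  by (simp add: reflection_def hdist_softmax cont_reflection hdist_eq_osc)

text \<open>In logarithmic coordinates, \<open>2 * ln m - ln f\<close> differs from
  \<open>ln f\<close> by twice \<open>ln m - ln f\<close>. This is the doubling property on which
  the Mazur--Ulam argument rests.\<close>

lemma hdist_reflection:
  assumes m: "m \<in> Delta K M" and f: "f \<in> Delta K M"
  shows "hdist (reflection m f) f = 2 * hdist f m"
proof -
  have "hdist (reflection m f) f = hdist (reflection m f) (softmax (\<lambda>x. ln (f x)))"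
    using f by (simp add: softmax_ln)
  also have "\<dots> = osc K (\<lambda>x. 2 * (ln (m x) - ln (f x)))"
    unfolding reflection_def
    using m f by (simp add: hdist_softmax cont_reflection Delta_D right_diff_distrib)
  also have "\<dots> = 2 * hdist f m"
    using osc_diff_commute[OF Delta_D(5)[OF f] Delta_D(5)[OF m]] m f
    by (subst osc_scale_nonneg) (simp_all add: hdist_eq_osc cont_ln_diff)
  finally show ?thesis .
qed

text \<open>The square root of \<open>f * g\<close>, normalised: the logarithmic midpoint, and the
  centre of the reflection that exchanges \<open>f\<close> and \<open>g\<close>.\<close>

definition geometric_mean :: "('a \<Rightarrow> real) \<Rightarrow> ('a \<Rightarrow> real) \<Rightarrow> 'a \<Rightarrow> real" where
  "geometric_mean f g = softmax (\<lambda>x. (ln (f x) + ln (g x)) / 2)"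

lemma cont_geometric_mean:
  assumes "f \<in> Delta K M" "g \<in> Delta K M"
  shows "continuous_map K euclideanreal (\<lambda>x. (ln (f x) + ln (g x)) / 2)"
  using assms by (intro continuous_map_add continuous_map_real_divide) (auto simp: Delta_D)

lemma geometric_mean_Delta: "\<lbrakk>f \<in> Delta K M; g \<in> Delta K M\<rbrakk> \<Longrightarrow> geometric_mean f g \<in> Delta K M"
  unfolding geometric_mean_def by (intro softmax_Delta cont_geometric_mean)

lemma reflection_geometric_mean:
  assumes "f \<in> Delta K M" "g \<in> Delta K M"
  shows "reflection (geometric_mean f g) f = g"
proof -
  have "reflection (geometric_mean f g) f = softmax (\<lambda>x. ln (g x))"
    unfolding reflection_def geometric_mean_def using assms
    by (intro softmax_cong) (auto simp: Delta_D ln_softmax cont_geometric_mean field_simps)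
  then show ?thesis using assms by (simp add: softmax_ln)
qed

end

text \<open>With \<open>f\<close> as the auxiliary point, the compatibility condition of the
  Mazur--Ulam theorem holds because both sides equal \<open>h g\<close>: each reflection exchanges
  the two points whose mean is its centre.\<close>

lemma surjective_isometry_geometric_mean:
  assumes "measured_compact K M" "measured_compact L N"
    and h: "surjective_isometry (Delta K M) (hilbert_dist K M) (Delta L N) (hilbert_dist L N) h"
    and f: "f \<in> Delta K M" and g: "g \<in> Delta K M"
  shows "h (measured_compact.geometric_mean K M f g) =
    measured_compact.geometric_mean L N (h f) (h g)"
proof -
  interpret K: measured_compact K M by fact
  interpret L: measured_compact L N by fact
  have hD: "h f \<in> Delta L N" if "f \<in> Delta K M" for f
    using h that by (auto simp: surjective_isometry_def)
  show ?thesis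
  proof (rule metric_Mazur_Ulam[OF K.Metric_space_hdist L.Metric_space_hdist,
        where \<rho> = "K.reflection (K.geometric_mean f g)"
          and \<sigma> = "L.reflection (L.geometric_mean (h f) (h g))" and a = f])
    show "h ` Delta K M = Delta L N" using h by (simp add: surjective_isometry_def)
    show "L.hdist (h x) (h y) = K.hdist x y" if "x \<in> Delta K M" "y \<in> Delta K M" for x y
      using h that hD by (simp add: surjective_isometry_def K.hdist_def L.hdist_def)
  qed (use f g hD in \<open>auto simp: K.geometric_mean_Delta L.geometric_mean_Delta
      K.reflection_Delta L.reflection_Delta K.reflection_involution L.reflection_involution
      K.reflection_isometry L.reflection_isometry K.hdist_reflection L.hdist_reflection
      K.reflection_geometric_mean L.reflection_geometric_mean\<close>)
qed

section \<open>Surjective isometries\<close>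

text \<open>Translates the multiplicative formula of the theorem into an affine map of
  logarithms.\<close>

lemma (in measured_compact) weighted_power_eq_softmax:
  assumes \<epsilon>: "\<epsilon> \<in> {-1, 1}"
    and "\<And>x. x \<in> topspace K \<Longrightarrow> 0 < g x" "\<And>x. x \<in> topspace K \<Longrightarrow> 0 < f x"
  shows "(\<lambda>x\<in>topspace K. g x * f x powi \<epsilon> / (LINT y|M. g y * f y powi \<epsilon>))
    = softmax (\<lambda>x. ln (g x) + \<epsilon> * ln (f x))"
proof -
  have eq: "g x * f x powi \<epsilon> = exp (ln (g x) + \<epsilon> * ln (f x))" if "x \<in> topspace K" for x
    using assms(2,3)[OF that] by (simp add: powi_pm1[OF \<epsilon>] exp_add)
  then have "(LINT y|M. g y * f y powi \<epsilon>) = (LINT y|M. exp (ln (g y) + \<epsilon> * ln (f y)))"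
    by (rule integral_cong_K)
  then show ?thesis using eq by (intro ext) (simp add: softmax_def restrict_def)
qed

lemma osc_comp:
  "\<theta> ` topspace K = topspace L \<Longrightarrow> osc K (\<lambda>x. u (\<theta> x)) = osc L u"
  unfolding osc_def by (metis (mono_tags, lifting) image_image)

locale two_measured_compact = K: measured_compact K M + L: measured_compact L N
  for K :: "'a topology" and M and L :: "'b topology" and N
begin

text \<open>The sign is real here, so that the lemma fits both the integer exponent of the theorem
  and the powers of -1 in the group action.\<close>

lemma softmax_weighted_isometry:
  assumes \<epsilon>: "\<epsilon> \<in> {-1, 1::real}" and \<theta>: "homeomorphic_map L K \<theta>"
    and u: "continuous_map L euclideanreal u"
    and h: "\<And>f. f \<in> Delta K M \<Longrightarrow> h f = L.softmax (\<lambda>x. u x + \<epsilon> * ln (f (\<theta> x)))"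
  shows "surjective_isometry (Delta K M) (hilbert_dist K M) (Delta L N) (hilbert_dist L N) h"
proof -
  obtain \<theta>' where \<theta>': "homeomorphic_maps L K \<theta> \<theta>'" using \<theta> homeomorphic_map_maps by blast
  have c\<theta>: "continuous_map L K \<theta>" and c\<theta>': "continuous_map K L \<theta>'"
    and inv: "\<And>x. x \<in> topspace L \<Longrightarrow> \<theta>' (\<theta> x) = x"
    using \<theta>' by (auto simp: homeomorphic_maps_def)
  have \<theta>K: "\<theta> x \<in> topspace K" if "x \<in> topspace L" for x
    using c\<theta> that by (auto simp: continuous_map_def)
  have comp: "continuous_map L euclideanreal (\<lambda>x. v (\<theta> x))"
    if "continuous_map K euclideanreal v" for v
    using continuous_map_compose[OF c\<theta> that] by (simp add: o_def)
  have comp': "continuous_map K euclideanreal (\<lambda>x. v (\<theta>' x))"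
    if "continuous_map L euclideanreal v" for v
    using continuous_map_compose[OF c\<theta>' that] by (simp add: o_def)
  have cont: "continuous_map L euclideanreal (\<lambda>x. u x + \<epsilon> * ln (f (\<theta> x)))" if "f \<in> Delta K M" for f
    using comp[OF K.Delta_D(5)[OF that]] u
    by (intro continuous_map_add continuous_map_real_mult) auto
  have iso: "hilbert_dist L N (h f) (h g) = hilbert_dist K M f g"
    if f: "f \<in> Delta K M" and g: "g \<in> Delta K M" for f g
  proof -
    let ?d = "\<lambda>y. ln (f y) - ln (g y)"
    have "hilbert_dist L N (h f) (h g) = osc L (\<lambda>x. \<epsilon> * ?d (\<theta> x))"
      using f g by (simp add: h L.hilbert_dist_softmax cont right_diff_distrib)
    also have "\<dots> = osc L (\<lambda>x. ?d (\<theta> x))"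
      using \<epsilon> L.osc_minus[OF comp[OF K.cont_ln_diff[OF f g]]] by auto
    also have "\<dots> = osc K ?d"
      using homeomorphic_imp_surjective_map[OF \<theta>] by (rule osc_comp)
    finally show ?thesis using f g by (simp add: K.hilbert_dist_eq_osc)
  qed
  have "f \<in> h ` Delta K M" if f: "f \<in> Delta L N" for f
  proof -
    \<comment> \<open>The solution of \<open>u + \<epsilon> * (?u \<circ> \<theta>) = ln f\<close>,
      using that \<open>\<epsilon>\<close> squares to one.\<close>
    let ?u = "\<lambda>p. \<epsilon> * (ln (f (\<theta>' p)) - u (\<theta>' p))"
    have cu: "continuous_map K euclideanreal ?u"
      using comp'[OF L.Delta_D(5)[OF f]] comp'[OF u]
      by (intro continuous_map_diff continuous_map_real_mult) auto
    have "h (K.softmax ?u) = L.softmax (\<lambda>x. ln (f x))"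
      unfolding h[OF K.softmax_Delta[OF cu]] using \<epsilon> \<theta>K inv
      by (intro L.softmax_cong) (auto simp: L.Delta_D[OF f] K.ln_softmax[OF cu])
    also have "\<dots> = f" by (rule L.softmax_ln[OF f])
    finally show ?thesis using K.softmax_Delta[OF cu] by (rule image_eqI[OF sym])
  qed
  moreover have "h f \<in> Delta L N" if "f \<in> Delta K M" for f
    using that by (simp add: h L.softmax_Delta cont)
  ultimately show ?thesis using iso unfolding surjective_isometry_def by blast
qed

lemma surjective_isometry_softmax:
  assumes h: "surjective_isometry (Delta K M) (hilbert_dist K M) (Delta L N) (hilbert_dist L N) h"
  obtains \<epsilon> :: int and \<theta> u where "\<epsilon> \<in> {-1, 1}" "homeomorphic_map L K \<theta>"
    "continuous_map L euclideanreal u"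
    "\<forall>f\<in>Delta K M. h f = L.softmax (\<lambda>x. u x + \<epsilon> * ln (f (\<theta> x)))"
proof -
  have hL: "h f \<in> Delta L N" if "f \<in> Delta K M" for f
    using h that by (auto simp: surjective_isometry_def)
  have "inj_on h (Delta K M)"
  proof (rule inj_onI)
    fix f g assume fg: "f \<in> Delta K M" "g \<in> Delta K M" "h f = h g"
    interpret Metric_space "Delta K M" K.hdist by (rule K.Metric_space_hdist)
    have "K.hdist f g = hilbert_dist L N (h f) (h g)"
      using fg(1,2) h by (simp add: K.hdist_def surjective_isometry_def)
    then have "K.hdist f g = 0" using fg by (simp add: hilbert_dist_def)
    then show "f = g" using fg by simp
  qed
  then have bij: "bij_betw h (Delta K M) (Delta L N)"
    using h by (simp add: bij_betw_def surjective_isometry_def)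
  define k where "k = inv_into (Delta K M) h"
  have kh: "k (h f) = f" if "f \<in> Delta K M" for f
    using bij that by (simp add: k_def bij_betw_inv_into_left)
  have hk: "h (k f) = f" if "f \<in> Delta L N" for f
    using bij that by (simp add: k_def bij_betw_inv_into_right)
  have k_bij: "bij_betw k (Delta L N) (Delta K M)"
    unfolding k_def by (rule bij_betw_inv_into) fact
  have kK: "k f \<in> Delta K M" if "f \<in> Delta L N" for f
    using k_bij that by (auto dest: bij_betwE)
  have k_iso: "hilbert_dist K M (k f) (k g) = hilbert_dist L N f g"
    if "f \<in> Delta L N" "g \<in> Delta L N" for f g
    using h that kK hk unfolding surjective_isometry_def by metis
  have k: "surjective_isometry (Delta L N) (hilbert_dist L N) (Delta K M) (hilbert_dist K M) k"
    using k_bij k_iso by (simp add: surjective_isometry_def bij_betw_def)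
  define e where "e = k (L.softmax (\<lambda>x. 0))"
  \<comment> \<open>The inverse isometry in logarithmic coordinates, translated by the image
    \<open>e\<close> of the origin so that \<open>S\<close> is zero at the zero function.\<close>
  define S where "S v p = ln (k (L.softmax v) p) - ln (e p)" for v p
  have kS: "k (L.softmax v) \<in> Delta K M" if "continuous_map L euclideanreal v" for v
    using kK L.softmax_Delta that by blast
  have eK: "e \<in> Delta K M" unfolding e_def by (rule kS) simp
  \<comment> \<open>Differences of values of the inverse before the translation; midpoint
    preservation makes them affine.\<close>
  define T where "T v p q = ln (k (L.softmax v) p) - ln (k (L.softmax v) q)" for v p q
  have T_mid: "T (\<lambda>x. (v x + w x) / 2) p q = (T v p q + T w p q) / 2"
    if v: "continuous_map L euclideanreal v" and w: "continuous_map L euclideanreal w"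
      and p: "p \<in> topspace K" and q: "q \<in> topspace K" for v w p q
  proof -
    have "L.softmax (\<lambda>x. (v x + w x) / 2) = L.geometric_mean (L.softmax v) (L.softmax w)"
      unfolding L.geometric_mean_def
      using L.cont_geometric_mean[OF L.softmax_Delta[OF v] L.softmax_Delta[OF w]]
      by (intro L.softmax_cong) (auto simp: L.ln_softmax v w field_simps)
    then have "k (L.softmax (\<lambda>x. (v x + w x) / 2))
        = K.geometric_mean (k (L.softmax v)) (k (L.softmax w))"
      using surjective_isometry_geometric_mean[OF L.measured_compact_axioms K.measured_compact_axioms k
          L.softmax_Delta[OF v] L.softmax_Delta[OF w]] by simp
    note eq = this[unfolded K.geometric_mean_def]
    show ?thesis
      unfolding T_def eq K.ln_softmax[OF K.cont_geometric_mean[OF kS[OF v] kS[OF w]] p]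
        K.ln_softmax[OF K.cont_geometric_mean[OF kS[OF v] kS[OF w]] q]
      by argo
  qed
  interpret osc_isometry L K S
  proof
    show "continuous_map K euclideanreal (S v)" if "continuous_map L euclideanreal v" for v
      unfolding S_def using K.cont_ln_diff[OF kS[OF that] eK] .
    show "osc K (S v) = osc L v" if v: "continuous_map L euclideanreal v" for v
    proof -
      have 0: "continuous_map L euclideanreal (\<lambda>x. 0)" by simp
      have "osc K (S v) = hilbert_dist K M (k (L.softmax v)) e"
        unfolding S_def by (rule K.hilbert_dist_eq_osc[OF kS[OF v] eK, symmetric])
      also have "\<dots> = hilbert_dist L N (L.softmax v) (L.softmax (\<lambda>x. 0))"
        unfolding e_def by (rule k_iso[OF L.softmax_Delta[OF v] L.softmax_Delta[OF 0]])
      also have "\<dots> = osc L v" using L.hilbert_dist_softmax[OF v 0] by simp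
      finally show ?thesis .
    qed
    show "S (\<lambda>x. v x + w x) p - S (\<lambda>x. v x + w x) q = (S v p - S v q) + (S w p - S w q)"
      if v: "continuous_map L euclideanreal v" and w: "continuous_map L euclideanreal w"
        and pq: "p \<in> topspace K" "q \<in> topspace K" for v w p q
    proof -
      have 0: "continuous_map L euclideanreal (\<lambda>x. 0)" by simp
      \<comment> \<open>Here \<open>v\<close> is the midpoint of \<open>2 v\<close> and 0, and
        \<open>v + w\<close> the midpoint of \<open>2 v\<close> and \<open>2 w\<close>. Combining
        the three midpoint identities gives additivity up to the value at 0, which \<open>S\<close>
        subtracts.\<close>
      have c2: "continuous_map L euclideanreal (\<lambda>x. 2 * v x)" "continuous_map L euclideanreal (\<lambda>x. 2 * w x)"
        using v w by (simp_all add: continuous_map_real_mult_left)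
      have "T v p q = (T (\<lambda>x. 2 * v x) p q + T (\<lambda>x. 0) p q) / 2"
        "T w p q = (T (\<lambda>x. 2 * w x) p q + T (\<lambda>x. 0) p q) / 2"
        "T (\<lambda>x. v x + w x) p q = (T (\<lambda>x. 2 * v x) p q + T (\<lambda>x. 2 * w x) p q) / 2"
        using T_mid[OF c2(1) 0 pq] T_mid[OF c2(2) 0 pq] T_mid[OF c2 pq]
        by (simp_all add: add_divide_distrib)
      then show ?thesis by (simp add: S_def T_def e_def)
    qed
    show "\<exists>v. continuous_map L euclideanreal v \<and>
        (\<forall>p\<in>topspace K. \<forall>q\<in>topspace K. S v p - S v q = u p - u q)"
      if u: "continuous_map K euclideanreal u" for u
    proof -
      \<comment> \<open>Adding \<open>ln e\<close> undoes the translation contained in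
        \<open>S\<close>.\<close>
      let ?w = "\<lambda>p. u p + ln (e p)"
      have w: "continuous_map K euclideanreal ?w"
        using u K.Delta_D(5)[OF eK] by (rule continuous_map_add)
      let ?f = "K.softmax ?w"
      have f: "?f \<in> Delta K M" using w by (rule K.softmax_Delta)
      have "k (L.softmax (\<lambda>x. ln (h ?f x))) = ?f" using L.softmax_ln[OF hL[OF f]] kh[OF f] by simp
      then have "\<forall>p\<in>topspace K. \<forall>q\<in>topspace K.
          S (\<lambda>x. ln (h ?f x)) p - S (\<lambda>x. ln (h ?f x)) q = u p - u q"
        by (simp add: S_def K.ln_softmax[OF w])
      then show ?thesis using L.Delta_D(5)[OF hL[OF f]] by blast
    qed
  qed
  obtain \<epsilon> :: int and \<theta> where \<epsilon>: "\<epsilon> \<in> {-1, 1}" and \<theta>: "homeomorphic_map L K \<theta>" and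
    rep: "\<forall>v x y. continuous_map L euclideanreal v \<longrightarrow> x \<in> topspace L \<longrightarrow> y \<in> topspace L \<longrightarrow>
      v x - v y = \<epsilon> * (S v (\<theta> x) - S v (\<theta> y))"
    by (rule homeomorphic_representation)
  have c\<theta>: "continuous_map L K \<theta>" using \<theta> by (rule homeomorphic_imp_continuous_map)
  \<comment> \<open>Applied to \<open>ln (h f)\<close>, the representation contains
    \<open>ln f - ln e\<close>; the \<open>ln e\<close> term, pulled back along
    \<open>\<theta>\<close>, becomes the weight.\<close>
  let ?u = "\<lambda>x. - \<epsilon> * ln (e (\<theta> x))"
  have comp: "continuous_map L euclideanreal (\<lambda>x. v (\<theta> x))"
    if "continuous_map K euclideanreal v" for v
    using continuous_map_compose[OF c\<theta> that] by (simp add: o_def)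
  have cu: "continuous_map L euclideanreal ?u"
    using comp[OF K.Delta_D(5)[OF eK]] by (intro continuous_map_real_mult) auto
  have "h f = L.softmax (\<lambda>x. ?u x + \<epsilon> * ln (f (\<theta> x)))" if f: "f \<in> Delta K M" for f
  proof -
    have v: "continuous_map L euclideanreal (\<lambda>x. ln (h f x))" by (rule L.Delta_D(5)[OF hL[OF f]])
    have "k (L.softmax (\<lambda>x. ln (h f x))) = f" using L.softmax_ln[OF hL[OF f]] kh[OF f] by simp
    then have S: "S (\<lambda>x. ln (h f x)) p = ln (f p) - ln (e p)" for p by (simp add: S_def)
    have "continuous_map L euclideanreal (\<lambda>x. ?u x + \<epsilon> * ln (f (\<theta> x)))"
      by (rule continuous_map_add[OF cu continuous_map_real_mult_left[OF comp[OF K.Delta_D(5)[OF f]]]])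
    moreover have "ln (h f x) - ln (h f y)
        = (?u x + \<epsilon> * ln (f (\<theta> x))) - (?u y + \<epsilon> * ln (f (\<theta> y)))"
      if "x \<in> topspace L" "y \<in> topspace L" for x y
    proof -
      have "ln (h f x) - ln (h f y) = \<epsilon> * ((ln (f (\<theta> x)) - ln (e (\<theta> x))) - (ln (f (\<theta> y)) - ln (e (\<theta> y))))"
        using rep[rule_format, OF v that] unfolding S .
      then show ?thesis by (simp add: algebra_simps)
    qed
    ultimately have "L.softmax (\<lambda>x. ln (h f x)) = L.softmax (\<lambda>x. ?u x + \<epsilon> * ln (f (\<theta> x)))"
      by (rule L.softmax_cong)
    then show ?thesis using L.softmax_ln[OF hL[OF f]] by simp
  qed
  then show thesis using that[OF \<epsilon> \<theta> cu] by blast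
qed

theorem surjective_isometry_iff:
  "surjective_isometry (Delta K M) (hilbert_dist K M) (Delta L N) (hilbert_dist L N) h \<longleftrightarrow>
    (\<exists>\<epsilon> \<in> {-1, 1::int}. \<exists>\<theta> g. homeomorphic_map L K \<theta> \<and>
      g \<in> C_space L \<and> (\<forall>x \<in> topspace L. 0 < g x) \<and>
      (\<forall>f \<in> Delta K M. h f = (\<lambda>x \<in> topspace L.
         g x * f (\<theta> x) powi \<epsilon> / (LINT y|N. g y * f (\<theta> y) powi \<epsilon>))))"
  (is "?iso \<longleftrightarrow> ?form")
proof
  assume ?iso
  then obtain \<epsilon> :: int and \<theta> u where \<epsilon>: "\<epsilon> \<in> {-1, 1}" and \<theta>: "homeomorphic_map L K \<theta>"
    and u: "continuous_map L euclideanreal u"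
    and h: "\<forall>f\<in>Delta K M. h f = L.softmax (\<lambda>x. u x + \<epsilon> * ln (f (\<theta> x)))"
    by (rule surjective_isometry_softmax)
  have \<theta>K: "\<theta> x \<in> topspace K" if "x \<in> topspace L" for x
    using homeomorphic_imp_surjective_map[OF \<theta>] that by blast
  let ?g = "\<lambda>x\<in>topspace L. exp (u x)"
  have "h f = (\<lambda>x \<in> topspace L. ?g x * f (\<theta> x) powi \<epsilon> / (LINT y|N. ?g y * f (\<theta> y) powi \<epsilon>))"
    if f: "f \<in> Delta K M" for f
  proof -
    have "(\<lambda>x \<in> topspace L. ?g x * f (\<theta> x) powi \<epsilon> / (LINT y|N. ?g y * f (\<theta> y) powi \<epsilon>))
        = L.softmax (\<lambda>x. ln (?g x) + \<epsilon> * ln (f (\<theta> x)))"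
      using \<epsilon> \<theta>K K.Delta_D(3)[OF f] by (intro L.weighted_power_eq_softmax) auto
    also have "\<dots> = L.softmax (\<lambda>x. u x + \<epsilon> * ln (f (\<theta> x)))"
    proof (rule L.softmax_cong)
      show "continuous_map L euclideanreal (\<lambda>x. u x + \<epsilon> * ln (f (\<theta> x)))"
        using u continuous_map_compose[OF homeomorphic_imp_continuous_map[OF \<theta>] K.Delta_D(5)[OF f]]
        by (intro continuous_map_add continuous_map_real_mult) (auto simp: o_def)
    qed simp
    finally show ?thesis using h f by simp
  qed
  moreover have "?g \<in> C_space L" using u by (intro L.restrict_C_space continuous_map_real_exp)
  moreover have "\<forall>x\<in>topspace L. 0 < ?g x" by simp
  ultimately show ?form using \<epsilon> \<theta> by blast
next
  assume ?form
  then obtain \<epsilon> :: int and \<theta> g where \<epsilon>: "\<epsilon> \<in> {-1, 1}" and \<theta>: "homeomorphic_map L K \<theta>"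
    and g: "g \<in> C_space L" "\<And>x. x \<in> topspace L \<Longrightarrow> 0 < g x"
    and h: "\<And>f. f \<in> Delta K M \<Longrightarrow> h f =
      (\<lambda>x \<in> topspace L. g x * f (\<theta> x) powi \<epsilon> / (LINT y|N. g y * f (\<theta> y) powi \<epsilon>))"
    by blast
  have \<theta>K: "\<theta> x \<in> topspace K" if "x \<in> topspace L" for x
    using homeomorphic_imp_surjective_map[OF \<theta>] that by blast
  show ?iso
  proof (rule softmax_weighted_isometry[OF _ \<theta>])
    show "real_of_int \<epsilon> \<in> {-1, 1}" using \<epsilon> by auto
    show "continuous_map L euclideanreal (\<lambda>x. ln (g x))"
      using g by (intro continuous_map_real_ln) (auto simp: C_space_def)
    show "h f = L.softmax (\<lambda>x. ln (g x) + \<epsilon> * ln (f (\<theta> x)))" if f: "f \<in> Delta K M" for f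
      unfolding h[OF f] using \<epsilon> g(2) \<theta>K K.Delta_D(3)[OF f]
      by (intro L.weighted_power_eq_softmax) auto
  qed
qed

end

section \<open>Quotients by constants\<close>

lemma comm_group_C_group: "comm_group (C_group K)"
proof (rule comm_groupI)
  fix f assume f: "f \<in> carrier (C_group K)"
  let ?g = "\<lambda>x\<in>topspace K. - f x"
  have "continuous_map K euclideanreal ?g"
    using continuous_map_eq[of K euclideanreal "\<lambda>x. - f x" ?g] f
    by (simp add: C_group_def C_space_def)
  then show "\<exists>g\<in>carrier (C_group K). g \<otimes>\<^bsub>C_group K\<^esub> f = \<one>\<^bsub>C_group K\<^esub>"
    by (intro bexI[of _ ?g]) (auto simp: C_group_def C_space_def)
next
  fix f g assume fg: "f \<in> carrier (C_group K)" "g \<in> carrier (C_group K)"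
  then show "f \<otimes>\<^bsub>C_group K\<^esub> g \<in> carrier (C_group K)"
    using continuous_map_eq[OF continuous_map_add[of K f g], of "\<lambda>x\<in>topspace K. f x + g x"]
    by (simp add: C_group_def C_space_def)
  show "f \<otimes>\<^bsub>C_group K\<^esub> g = g \<otimes>\<^bsub>C_group K\<^esub> f"
    by (simp add: C_group_def add.commute)
next
  show "\<one>\<^bsub>C_group K\<^esub> \<in> carrier (C_group K)"
    using continuous_map_eq[of K euclideanreal "\<lambda>x. 0" "\<lambda>x\<in>topspace K. 0"]
    by (simp add: C_group_def C_space_def)
next
  fix f g h assume "f \<in> carrier (C_group K)" "g \<in> carrier (C_group K)" "h \<in> carrier (C_group K)"
  show "f \<otimes>\<^bsub>C_group K\<^esub> g \<otimes>\<^bsub>C_group K\<^esub> h = f \<otimes>\<^bsub>C_group K\<^esub> (g \<otimes>\<^bsub>C_group K\<^esub> h)"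
    by (auto simp: C_group_def)
next
  fix f assume "f \<in> carrier (C_group K)"
  then show "\<one>\<^bsub>C_group K\<^esub> \<otimes>\<^bsub>C_group K\<^esub> f = f"
    by (auto simp: C_group_def C_space_def extensional_def)
qed

lemma constants_normal: "constants K \<lhd> C_group K"
proof -
  interpret comm_group "C_group K" by (rule comm_group_C_group)
  have C: "(\<lambda>x\<in>topspace K. c) \<in> carrier (C_group K)" for c :: real
    using continuous_map_eq[of K euclideanreal "\<lambda>x. c" "\<lambda>x\<in>topspace K. c"]
    by (simp add: C_group_def C_space_def)
  have "subgroup (constants K) (C_group K)"
  proof (rule subgroupI)
    show "constants K \<subseteq> carrier (C_group K)" using C by (auto simp: constants_def)
    show "constants K \<noteq> {}" by (simp add: constants_def)
    fix a b assume "a \<in> constants K" "b \<in> constants K"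
    then obtain c d where cd: "a = (\<lambda>x\<in>topspace K. c)" "b = (\<lambda>x\<in>topspace K. d)"
      by (auto simp: constants_def)
    have "a \<otimes>\<^bsub>C_group K\<^esub> b = (\<lambda>x\<in>topspace K. c + d)" using cd by (auto simp: C_group_def)
    then show "a \<otimes>\<^bsub>C_group K\<^esub> b \<in> constants K" by (simp add: constants_def)
    have "(\<lambda>x\<in>topspace K. - c) \<otimes>\<^bsub>C_group K\<^esub> a = \<one>\<^bsub>C_group K\<^esub>"
      using cd by (auto simp: C_group_def)
    then have "inv\<^bsub>C_group K\<^esub> a = (\<lambda>x\<in>topspace K. - c)" 
      using C cd by (intro inv_equality) auto
    then show "inv\<^bsub>C_group K\<^esub> a \<in> constants K" by (simp add: constants_def)
  qed
  then show ?thesis by (rule subgroup_imp_normal)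
qed

text \<open>The coset of the restriction of \<open>u\<close>. Taking \<open>u\<close> on the whole
  type lets expressions such as \<open>\<lambda>x. u x + v x\<close> be used as representatives
  without restricting them.\<close>

definition cls :: "'a topology \<Rightarrow> ('a \<Rightarrow> real) \<Rightarrow> ('a \<Rightarrow> real) set" where
  "cls K u = range (\<lambda>c. \<lambda>x\<in>topspace K. c + u x)"

lemma cls_eq_r_coset: "cls K u = constants K #>\<^bsub>C_group K\<^esub> restrict u (topspace K)"
proof -
  have "(\<lambda>x\<in>topspace K. c + u x) =
      (\<lambda>x\<in>topspace K. c) \<otimes>\<^bsub>C_group K\<^esub> restrict u (topspace K)" for c
    by (auto simp: C_group_def)
  then show ?thesis by (auto simp: cls_def r_coset_def constants_def)
qed

lemma cls_eq_iff:
  "cls K u = cls K v \<longleftrightarrow> (\<forall>x\<in>topspace K. \<forall>y\<in>topspace K. u x - u y = v x - v y)"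
proof
  assume "cls K u = cls K v"
  moreover have "(\<lambda>x\<in>topspace K. 0 + u x) \<in> cls K u" unfolding cls_def by (rule rangeI)
  ultimately obtain c where c: "(\<lambda>x\<in>topspace K. 0 + u x) = (\<lambda>x\<in>topspace K. c + v x)"
    by (auto simp: cls_def)
  have "u x = c + v x" if "x \<in> topspace K" for x using fun_cong[OF c, of x] that by simp
  then show "\<forall>x\<in>topspace K. \<forall>y\<in>topspace K. u x - u y = v x - v y" by simp
next
  have sub: "cls K u \<subseteq> cls K v"
    if eq: "\<forall>x\<in>topspace K. \<forall>y\<in>topspace K. u x - u y = v x - v y" for u v
  proof
    fix f assume "f \<in> cls K u"
    then obtain c where f: "f = (\<lambda>x\<in>topspace K. c + u x)" by (auto simp: cls_def)
    obtain d where "u x = d + v x" if "x \<in> topspace K" for x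
    proof (cases "topspace K = {}")
      case False
      then obtain a where a: "a \<in> topspace K" by blast
      have "u x = (u a - v a) + v x" if "x \<in> topspace K" for x
        using bspec[OF bspec[OF eq that] a] by linarith
      then show thesis by (rule that)
    qed (use that in auto)
    then have "f = (\<lambda>x\<in>topspace K. (c + d) + v x)" unfolding f by (intro restrict_ext) simp
    then show "f \<in> cls K v" unfolding cls_def by (rule range_eqI)
  qed
  assume eq: "\<forall>x\<in>topspace K. \<forall>y\<in>topspace K. u x - u y = v x - v y"
  then show "cls K u = cls K v" using sub[of u v] sub[of v u] by (metis subset_antisym)
qed

lemma carrier_C_bar: "carrier (C_bar K) = {cls K u |u. continuous_map K euclideanreal u}"
proof (intro equalityI subsetI)
  fix F assume "F \<in> carrier (C_bar K)"
  then obtain f where f: "f \<in> C_space K" "F = constants K #>\<^bsub>C_group K\<^esub> f"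
    by (auto simp: C_bar_def carrier_FactGroup C_group_def)
  then have "restrict f (topspace K) = f" by (auto simp: C_space_def extensional_restrict)
  then have "F = cls K f" using f(2) cls_eq_r_coset[of K f] by simp
  then show "F \<in> {cls K u |u. continuous_map K euclideanreal u}"
    using f by (auto simp: C_space_def)
next
  fix F assume "F \<in> {cls K u |u. continuous_map K euclideanreal u}"
  then obtain u where u: "continuous_map K euclideanreal u" "F = cls K u" by blast
  have "restrict u (topspace K) \<in> carrier (C_group K)"
    using continuous_map_eq[OF u(1), of "restrict u (topspace K)"]
    by (simp add: C_group_def C_space_def)
  then show "F \<in> carrier (C_bar K)" using u(2) by (auto simp: C_bar_def carrier_FactGroup cls_eq_r_coset)
qed

lemma mult_C_bar:
  assumes "continuous_map K euclideanreal u" "continuous_map K euclideanreal v"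
  shows "cls K u \<otimes>\<^bsub>C_bar K\<^esub> cls K v = cls K (\<lambda>x. u x + v x)"
proof -
  interpret normal "constants K" "C_group K" by (rule constants_normal)
  have C: "restrict w (topspace K) \<in> carrier (C_group K)" if "continuous_map K euclideanreal w" for w
    using continuous_map_eq[OF that, of "restrict w (topspace K)"]
    by (simp add: C_group_def C_space_def)
  have "restrict u (topspace K) \<otimes>\<^bsub>C_group K\<^esub> restrict v (topspace K)
      = restrict (\<lambda>x. u x + v x) (topspace K)"
    by (auto simp: C_group_def)
  then show ?thesis
    unfolding cls_eq_r_coset C_bar_def mult_FactGroup
    using rcos_sum[OF C[OF assms(1)] C[OF assms(2)]] by simp
qed

text \<open>The image of a coset is a full coset because multiplication by the sign permutes the
  constants.\<close>

lemma C_bar_action_cls: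
  assumes k: "k \<in> {0, 1}" and \<theta>: "\<theta> ` topspace K = topspace K"
  shows "C_bar_action K (k, \<theta>) (cls K u)
    = cls K (\<lambda>x. (-1) powi k * u (inv_into (topspace K) \<theta> x))"
proof -
  let ?\<sigma> = "inv_into (topspace K) \<theta>" and ?s = "(-1 :: real) powi k"
  have \<sigma>: "?\<sigma> x \<in> topspace K" if "x \<in> topspace K" for x
    using that \<theta> by (metis inv_into_into)
  have ss: "?s * ?s = 1" using k by auto
  have act: "C_bar_action K (k, \<theta>) (cls K u)
      = range (\<lambda>c. \<lambda>x\<in>topspace K. ?s * (c + u (?\<sigma> x)))"
    unfolding C_bar_action_def cls_def case_prod_conv image_image
    by (intro image_cong refl restrict_ext) (simp add: \<sigma>)
  have eq: "(\<lambda>x\<in>topspace K. ?s * (c + u (?\<sigma> x))) = (\<lambda>x\<in>topspace K. ?s * c + ?s * u (?\<sigma> x))" for c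
    by (simp add: distrib_left)
  have surj: "range (\<lambda>c. ?s * c) = UNIV"
  proof (rule surjI)
    show "?s * (?s * c) = c" for c using ss by (simp flip: mult.assoc)
  qed
  have "range (\<lambda>c. \<lambda>x\<in>topspace K. ?s * c + ?s * u (?\<sigma> x))
      = (\<lambda>c. \<lambda>x\<in>topspace K. c + ?s * u (?\<sigma> x)) ` range (\<lambda>c. ?s * c)"
    by (simp only: image_image)
  then show ?thesis unfolding act eq surj by (simp only: cls_def)
qed

lemma homeomorphic_map_inv_into:
  assumes "homeomorphic_map K L \<theta>"
  shows "homeomorphic_map L K (inv_into (topspace K) \<theta>)"
proof -
  obtain \<sigma> where \<sigma>: "homeomorphic_maps K L \<theta> \<sigma>" using assms homeomorphic_map_maps by blast
  have "\<sigma> y = inv_into (topspace K) \<theta> y" if y: "y \<in> topspace L" for y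
  proof -
    have "\<theta> (\<sigma> y) = y" "\<sigma> y \<in> topspace K"
      using \<sigma> y by (auto simp: homeomorphic_maps_def continuous_map_def)
    then show ?thesis
      using inv_into_f_f[OF homeomorphic_imp_injective_map[OF assms], of "\<sigma> y"] by simp
  qed
  then show ?thesis using \<sigma> homeomorphic_map_eq[of L K \<sigma>] by (auto simp: homeomorphic_maps_map)
qed

text \<open>Inverting a bijective homomorphism uses only closure of the product in \<open>G\<close>,
  so the lemma applies directly to the semidirect product.\<close>

lemma iso_inv_into:
  assumes \<phi>: "\<phi> \<in> iso G H"
    and closed: "\<And>x y. \<lbrakk>x \<in> carrier G; y \<in> carrier G\<rbrakk> \<Longrightarrow> x \<otimes>\<^bsub>G\<^esub> y \<in> carrier G"
  shows "inv_into (carrier G) \<phi> \<in> iso H G"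
proof (rule isoI)
  have b: "bij_betw \<phi> (carrier G) (carrier H)" and hom: "\<phi> \<in> hom G H"
    using \<phi> by (auto simp: iso_def)
  show b': "bij_betw (inv_into (carrier G) \<phi>) (carrier H) (carrier G)"
    using b by (rule bij_betw_inv_into)
  show "inv_into (carrier G) \<phi> \<in> hom H G"
  proof (rule homI)
    show mem: "inv_into (carrier G) \<phi> x \<in> carrier G" if "x \<in> carrier H" for x
      using b' that by (auto dest: bij_betwE)
    fix x y assume xy: "x \<in> carrier H" "y \<in> carrier H"
    let ?x = "inv_into (carrier G) \<phi> x" and ?y = "inv_into (carrier G) \<phi> y"
    have "\<phi> (?x \<otimes>\<^bsub>G\<^esub> ?y) = x \<otimes>\<^bsub>H\<^esub> y"
      using hom_mult[OF hom mem mem] xy b by (simp add: bij_betw_inv_into_right)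
    then show "inv_into (carrier G) \<phi> (x \<otimes>\<^bsub>H\<^esub> y) = ?x \<otimes>\<^bsub>G\<^esub> ?y"
      using bij_betw_inv_into_left[OF b closed[OF mem mem]] xy by metis
  qed
qed

section \<open>The isometry group\<close>

abbreviation (input) isometry_group_model ::
    "'a topology \<Rightarrow> (('a \<Rightarrow> real) set \<times> int \<times> ('a \<Rightarrow> 'a)) monoid" where
  "isometry_group_model K \<equiv>
     semidirect_product (C_bar K) (integer_mod_group 2 \<times>\<times> Homeo K) (C_bar_action K)"

context measured_compact
begin

sublocale two: two_measured_compact K M K M by unfold_locales

abbreviation inverse_on :: "('a \<Rightarrow> 'a) \<Rightarrow> 'a \<Rightarrow> 'a" where
  "inverse_on \<theta> \<equiv> inv_into (topspace K) \<theta>"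

text \<open>The inverse of \<open>\<theta>\<close> makes the assignment a homomorphism and not an
  antihomomorphism, in agreement with the action on \<open>C_bar\<close>. The chosen representative
  does not matter, as \<open>isometry_of_eq\<close> shows.\<close>

definition isometry_of :: "('a \<Rightarrow> real) set \<times> int \<times> ('a \<Rightarrow> 'a) \<Rightarrow> ('a \<Rightarrow> real) \<Rightarrow> 'a \<Rightarrow> real" where
  "isometry_of = (\<lambda>(F, k, \<theta>). \<lambda>f\<in>Delta K M.
     softmax (\<lambda>x. (SOME u. continuous_map K euclideanreal u \<and> cls K u = F) x
       + (-1) powi k * ln (f (inverse_on \<theta> x))))"

lemma Homeo_D:
  assumes "\<theta> \<in> carrier (Homeo K)"
  shows "homeomorphic_map K K \<theta>" "\<theta> \<in> extensional (topspace K)"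
    "homeomorphic_map K K (inverse_on \<theta>)"
    "\<And>x. x \<in> topspace K \<Longrightarrow> \<theta> x \<in> topspace K"
    "\<And>x. x \<in> topspace K \<Longrightarrow> inverse_on \<theta> x \<in> topspace K"
    "\<And>x. x \<in> topspace K \<Longrightarrow> inverse_on \<theta> (\<theta> x) = x"
    "\<And>x. x \<in> topspace K \<Longrightarrow> \<theta> (inverse_on \<theta> x) = x"
proof -
  show \<theta>: "homeomorphic_map K K \<theta>" "\<theta> \<in> extensional (topspace K)"
    using assms by (simp_all add: Homeo_def)
  then show i: "homeomorphic_map K K (inverse_on \<theta>)" by (intro homeomorphic_map_inv_into)
  have s: "\<theta> ` topspace K = topspace K" using \<theta>(1) by (rule homeomorphic_imp_surjective_map)
  then show "\<And>x. x \<in> topspace K \<Longrightarrow> \<theta> x \<in> topspace K" by blast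
  show "\<And>x. x \<in> topspace K \<Longrightarrow> inverse_on \<theta> x \<in> topspace K"
    using homeomorphic_imp_surjective_map[OF i] by blast
  show "\<And>x. x \<in> topspace K \<Longrightarrow> inverse_on \<theta> (\<theta> x) = x"
    by (rule inv_into_f_f[OF homeomorphic_imp_injective_map[OF \<theta>(1)]])
  show "\<And>x. x \<in> topspace K \<Longrightarrow> \<theta> (inverse_on \<theta> x) = x"
    by (rule f_inv_into_f) (simp add: s)
qed

lemma Homeo_mult:
  assumes \<theta>: "\<theta> \<in> carrier (Homeo K)" and \<eta>: "\<eta> \<in> carrier (Homeo K)"
  shows "compose (topspace K) \<theta> \<eta> \<in> carrier (Homeo K)"
    "\<And>x. x \<in> topspace K \<Longrightarrow>
      inverse_on (compose (topspace K) \<theta> \<eta>) x = inverse_on \<eta> (inverse_on \<theta> x)"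
proof -
  have "homeomorphic_map K K (\<theta> \<circ> \<eta>)"
    using Homeo_D(1)[OF \<eta>] Homeo_D(1)[OF \<theta>] by (rule homeomorphic_map_compose)
  then have "homeomorphic_map K K (compose (topspace K) \<theta> \<eta>)"
    by (rule homeomorphic_map_eq) (simp add: compose_def)
  then show c: "compose (topspace K) \<theta> \<eta> \<in> carrier (Homeo K)"
    by (simp add: Homeo_def compose_def)
  fix x assume x: "x \<in> topspace K"
  let ?y = "inverse_on \<eta> (inverse_on \<theta> x)"
  have y: "?y \<in> topspace K" using Homeo_D(5)[OF \<eta>] Homeo_D(5)[OF \<theta>] x by blast
  have "compose (topspace K) \<theta> \<eta> ?y = x"
    using y x Homeo_D(5,7)[OF \<theta>] Homeo_D(7)[OF \<eta>] by (simp add: compose_def)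
  then show "inverse_on (compose (topspace K) \<theta> \<eta>) x = ?y" using Homeo_D(6)[OF c y] by simp
qed

lemma cont_comp_homeo:
  assumes "homeomorphic_map K K \<sigma>" "continuous_map K euclideanreal u"
  shows "continuous_map K euclideanreal (\<lambda>x. u (\<sigma> x))"
  using continuous_map_compose[OF homeomorphic_imp_continuous_map[OF assms(1)] assms(2)]
  by (simp add: o_def)

lemma cont_isometry_of:
  assumes "continuous_map K euclideanreal u" "\<theta> \<in> carrier (Homeo K)" "f \<in> Delta K M"
  shows "continuous_map K euclideanreal (\<lambda>x. u x + c * ln (f (inverse_on \<theta> x)))"
  using assms cont_comp_homeo[OF Homeo_D(3) Delta_D(5)]
  by (intro continuous_map_add continuous_map_real_mult_left) auto

lemma isometry_of_eq:
  assumes u: "continuous_map K euclideanreal u" and \<theta>: "\<theta> \<in> carrier (Homeo K)"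
    and f: "f \<in> Delta K M"
  shows "isometry_of (cls K u, k, \<theta>) f =
    softmax (\<lambda>x. u x + (-1) powi k * ln (f (inverse_on \<theta> x)))"
proof -
  define v where "v = (SOME v. continuous_map K euclideanreal v \<and> cls K v = cls K u)"
  have v: "continuous_map K euclideanreal v \<and> cls K v = cls K u"
    unfolding v_def by (rule someI[of _ u]) (simp add: u)
  have "softmax (\<lambda>x. v x + (-1) powi k * ln (f (inverse_on \<theta> x))) =
      softmax (\<lambda>x. u x + (-1) powi k * ln (f (inverse_on \<theta> x)))"
  proof (rule softmax_cong[OF cont_isometry_of[OF u \<theta> f]])
    fix x y assume xy: "x \<in> topspace K" "y \<in> topspace K"
    have "v x - v y = u x - u y" using v xy unfolding cls_eq_iff by blast
    then show "v x + (-1) powi k * ln (f (inverse_on \<theta> x)) - (v y + (-1) powi k * ln (f (inverse_on \<theta> y)))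
      = u x + (-1) powi k * ln (f (inverse_on \<theta> x)) - (u y + (-1) powi k * ln (f (inverse_on \<theta> y)))"
      by linarith
  qed
  then show ?thesis using f by (simp add: isometry_of_def flip: v_def)
qed

lemma carrier_model:
  "carrier (isometry_group_model K) =
    {(cls K u, k, \<theta>) |u k \<theta>. continuous_map K euclideanreal u \<and> k \<in> {0, 1} \<and> \<theta> \<in> carrier (Homeo K)}"
proof -
  have "{0..<2} = {0, 1 :: int}" by auto
  then show ?thesis
    by (auto simp: semidirect_product_def carrier_C_bar carrier_integer_mod_group)
qed

lemma modelI:
  "\<lbrakk>continuous_map K euclideanreal u; k \<in> {0, 1}; \<theta> \<in> carrier (Homeo K)\<rbrakk>
    \<Longrightarrow> (cls K u, k, \<theta>) \<in> carrier (isometry_group_model K)"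
  unfolding carrier_model by blast

lemma modelE:
  assumes "a \<in> carrier (isometry_group_model K)"
  obtains u k \<theta> where "a = (cls K u, k, \<theta>)" "continuous_map K euclideanreal u" "k \<in> {0, 1}"
    "\<theta> \<in> carrier (Homeo K)"
  using assms unfolding carrier_model by blast

lemma cont_action:
  assumes "continuous_map K euclideanreal u" "continuous_map K euclideanreal v"
    "\<theta> \<in> carrier (Homeo K)"
  shows "continuous_map K euclideanreal (\<lambda>x. u x + c * v (inverse_on \<theta> x))"
  using assms cont_comp_homeo[OF Homeo_D(3)]
  by (intro continuous_map_add continuous_map_real_mult_left) auto

lemma mult_model:
  assumes u: "continuous_map K euclideanreal u" and v: "continuous_map K euclideanreal v"
    and k: "k \<in> {0, 1}" and \<theta>: "\<theta> \<in> carrier (Homeo K)"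
  shows "(cls K u, k, \<theta>) \<otimes>\<^bsub>isometry_group_model K\<^esub> (cls K v, l, \<eta>) =
    (cls K (\<lambda>x. u x + (-1) powi k * v (inverse_on \<theta> x)), (k + l) mod 2, compose (topspace K) \<theta> \<eta>)"
proof -
  have "continuous_map K euclideanreal (\<lambda>x. (-1) powi k * v (inverse_on \<theta> x))"
    using cont_comp_homeo[OF Homeo_D(3)[OF \<theta>] v] by (rule continuous_map_real_mult_left)
  then have "cls K u \<otimes>\<^bsub>C_bar K\<^esub> C_bar_action K (k, \<theta>) (cls K v)
      = cls K (\<lambda>x. u x + (-1) powi k * v (inverse_on \<theta> x))"
    using C_bar_action_cls[OF k homeomorphic_imp_surjective_map[OF Homeo_D(1)[OF \<theta>]]] u
    by (simp add: mult_C_bar)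
  then show ?thesis by (simp add: semidirect_product_def DirProd_def Homeo_def)
qed

lemma isometry_of_Isom:
  assumes "a \<in> carrier (isometry_group_model K)"
  shows "isometry_of a \<in> carrier (Isom (Delta K M) (hilbert_dist K M))"
proof -
  obtain u k \<theta> where a: "a = (cls K u, k, \<theta>)" and u: "continuous_map K euclideanreal u"
    and k: "k \<in> {0, 1}" and \<theta>: "\<theta> \<in> carrier (Homeo K)"
    using assms by (rule modelE)
  have "surjective_isometry (Delta K M) (hilbert_dist K M) (Delta K M) (hilbert_dist K M) (isometry_of a)"
  proof (rule two.softmax_weighted_isometry[OF _ Homeo_D(3)[OF \<theta>] u])
    show "(-1) powi k \<in> {-1, 1::real}" using k by auto
  qed (simp add: a isometry_of_eq[OF u \<theta>])
  then show ?thesis by (auto simp: Isom_def isometry_of_def a)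
qed

text \<open>Substituting one affine map of logarithms into the other gives the semidirect product
  rule; the normalising constant of the inner \<open>softmax\<close> is absorbed by the outer
  one.\<close>

lemma isometry_of_hom:
  "isometry_of \<in> hom (isometry_group_model K) (Isom (Delta K M) (hilbert_dist K M))"
proof (rule homI)
  fix a b assume a: "a \<in> carrier (isometry_group_model K)" and b: "b \<in> carrier (isometry_group_model K)"
  obtain u k \<theta> where a_eq: "a = (cls K u, k, \<theta>)" and u: "continuous_map K euclideanreal u"
    and k: "k \<in> {0, 1}" and \<theta>: "\<theta> \<in> carrier (Homeo K)"
    using a by (rule modelE)
  obtain v l \<eta> where b_eq: "b = (cls K v, l, \<eta>)" and v: "continuous_map K euclideanreal v"
    and l: "l \<in> {0, 1}" and \<eta>: "\<eta> \<in> carrier (Homeo K)"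
    using b by (rule modelE)
  note uv = cont_action[OF u v \<theta>, of "(-1) powi k"]
  note \<theta>\<eta> = Homeo_mult[OF \<theta> \<eta>]
  have sign: "(-1 :: real) powi ((k + l) mod 2) = (-1) powi k * (-1) powi l" using k l by auto
  have "isometry_of (a \<otimes>\<^bsub>isometry_group_model K\<^esub> b) f = compose (Delta K M) (isometry_of a) (isometry_of b) f" for f
  proof (cases "f \<in> Delta K M")
    case f: True
    let ?w = "\<lambda>x. v x + (-1) powi l * ln (f (inverse_on \<eta> x))"
    have w: "continuous_map K euclideanreal ?w" using v \<eta> f by (rule cont_isometry_of)
    have "isometry_of (a \<otimes>\<^bsub>isometry_group_model K\<^esub> b) f =
        softmax (\<lambda>x. (u x + (-1) powi k * v (inverse_on \<theta> x)) +
          (-1) powi ((k + l) mod 2) * ln (f (inverse_on (compose (topspace K) \<theta> \<eta>) x)))"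
      unfolding a_eq b_eq mult_model[OF u v k \<theta>] by (rule isometry_of_eq[OF uv \<theta>\<eta>(1) f])
    also have "\<dots> = softmax (\<lambda>x. u x + (-1) powi k * ln (softmax ?w (inverse_on \<theta> x)))"
      by (rule softmax_cong[OF cont_isometry_of[OF u \<theta> softmax_Delta[OF w]]])
        (simp add: sign \<theta>\<eta>(2) ln_softmax[OF w] Homeo_D(5)[OF \<theta>] algebra_simps)
    also have "\<dots> = isometry_of a (isometry_of b f)"
      unfolding a_eq b_eq
      by (simp only: isometry_of_eq[OF v \<eta> f] isometry_of_eq[OF u \<theta> softmax_Delta[OF w]])
    finally show ?thesis using f by (simp add: compose_def)
  qed (simp add: isometry_of_def compose_def split: prod.split)
  then show "isometry_of (a \<otimes>\<^bsub>isometry_group_model K\<^esub> b)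
      = isometry_of a \<otimes>\<^bsub>Isom (Delta K M) (hilbert_dist K M)\<^esub> isometry_of b"
    by (auto simp: Isom_def)
qed (rule isometry_of_Isom)

lemma isometry_of_surj:
  assumes "h \<in> carrier (Isom (Delta K M) (hilbert_dist K M))"
  shows "h \<in> isometry_of ` carrier (isometry_group_model K)"
proof -
  have h: "h \<in> extensional (Delta K M)"
    and iso: "surjective_isometry (Delta K M) (hilbert_dist K M) (Delta K M) (hilbert_dist K M) h"
    using assms by (auto simp: Isom_def)
  obtain \<epsilon> :: int and \<sigma> u where \<epsilon>: "\<epsilon> \<in> {-1, 1}" and \<sigma>: "homeomorphic_map K K \<sigma>"
    and u: "continuous_map K euclideanreal u"
    and eq: "\<forall>f\<in>Delta K M. h f = softmax (\<lambda>x. u x + \<epsilon> * ln (f (\<sigma> x)))"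
    by (rule two.surjective_isometry_softmax[OF iso])
  define k :: int where "k = (if \<epsilon> = 1 then 0 else 1)"
  have k: "k \<in> {0, 1}" "(-1) powi k = real_of_int \<epsilon>" using \<epsilon> by (auto simp: k_def)
  \<comment> \<open>The representation composes with \<open>\<sigma>\<close>, the model with an
    inverse; hence the inverse of \<open>\<sigma>\<close>, restricted to be extensional.\<close>
  define \<theta> where "\<theta> = restrict (inverse_on \<sigma>) (topspace K)"
  have "homeomorphic_map K K \<theta>"
    unfolding \<theta>_def by (rule homeomorphic_map_eq[OF homeomorphic_map_inv_into[OF \<sigma>]]) simp
  then have \<theta>: "\<theta> \<in> carrier (Homeo K)" by (simp add: Homeo_def \<theta>_def)
  have inv: "inverse_on \<theta> x = \<sigma> x" if x: "x \<in> topspace K" for x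
  proof -
    have "\<sigma> x \<in> topspace K" using homeomorphic_imp_surjective_map[OF \<sigma>] x by blast
    moreover from this have "\<theta> (\<sigma> x) = x"
      using inv_into_f_f[OF homeomorphic_imp_injective_map[OF \<sigma>] x] by (simp add: \<theta>_def)
    ultimately show ?thesis using Homeo_D(6)[OF \<theta>, of "\<sigma> x"] by simp
  qed
  have "h f = isometry_of (cls K u, k, \<theta>) f" for f
  proof (cases "f \<in> Delta K M")
    case True
    have "continuous_map K euclideanreal (\<lambda>x. u x + \<epsilon> * ln (f (\<sigma> x)))"
      by (intro continuous_map_add u continuous_map_real_mult_left cont_comp_homeo[OF \<sigma> Delta_D(5)[OF True]])
    then have "softmax (\<lambda>x. u x + \<epsilon> * ln (f (inverse_on \<theta> x))) = softmax (\<lambda>x. u x + \<epsilon> * ln (f (\<sigma> x)))"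
      by (rule softmax_cong) (simp add: inv)
    then show ?thesis using eq True by (simp add: isometry_of_eq[OF u \<theta> True] k(2))
  qed (use h in \<open>simp add: isometry_of_def extensional_def\<close>)
  then have "h = isometry_of (cls K u, k, \<theta>)" by blast
  moreover have "(cls K u, k, \<theta>) \<in> carrier (isometry_group_model K)"
    using u k(1) \<theta> by (rule modelI)
  ultimately show ?thesis by blast
qed

text \<open>Equal isometries give one linear identity per test function. A third point permits a
  test function that is visible through one homeomorphism and invisible through the other, which
  rules out that a different homeomorphism is compensated by the sign.\<close>

lemma isometry_of_inj:
  assumes three: "infinite (topspace K) \<or> 3 \<le> card (topspace K)"
  shows "inj_on isometry_of (carrier (isometry_group_model K))"
proof (rule inj_onI)
  have third: "\<exists>z\<in>topspace K. z \<noteq> a \<and> z \<noteq> b" for a b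
  proof (rule ccontr)
    assume "\<not> ?thesis"
    then have sub: "topspace K \<subseteq> {a, b}" by blast
    then have "finite (topspace K)" by (rule finite_subset) simp
    moreover have "card (topspace K) \<le> card {a, b}" using sub by (intro card_mono) auto
    moreover have "card {a, b} \<le> 2" by (simp add: card_insert_if)
    ultimately show False using three by simp
  qed
  fix a b assume a: "a \<in> carrier (isometry_group_model K)" and b: "b \<in> carrier (isometry_group_model K)"
    and ab: "isometry_of a = isometry_of b"
  obtain u k \<theta> where a_eq: "a = (cls K u, k, \<theta>)" and u: "continuous_map K euclideanreal u"
    and k: "k \<in> {0, 1}" and \<theta>: "\<theta> \<in> carrier (Homeo K)"
    using a by (rule modelE)
  obtain v l \<eta> where b_eq: "b = (cls K v, l, \<eta>)" and v: "continuous_map K euclideanreal v"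
    and l: "l \<in> {0, 1}" and \<eta>: "\<eta> \<in> carrier (Homeo K)"
    using b by (rule modelE)
  define s t :: real where "s = (-1) powi k" and "t = (-1) powi l"
  have st: "s \<noteq> 0" "t \<noteq> 0" by (simp_all add: s_def t_def)
  let ?\<theta> = "inverse_on \<theta>" and ?\<eta> = "inverse_on \<eta>"
  have rel: "(u x - u y) + s * (w (?\<theta> x) - w (?\<theta> y)) = (v x - v y) + t * (w (?\<eta> x) - w (?\<eta> y))"
    if w: "continuous_map K euclideanreal w" and x: "x \<in> topspace K" and y: "y \<in> topspace K" for w x y
  proof -
    note f = softmax_Delta[OF w]
    note cu = cont_isometry_of[OF u \<theta> f, of s] and cv = cont_isometry_of[OF v \<eta> f, of t]
    have eq: "softmax (\<lambda>x. u x + s * ln (softmax w (?\<theta> x))) = softmax (\<lambda>x. v x + t * ln (softmax w (?\<eta> x)))"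
      using fun_cong[OF ab, of "softmax w"]
      unfolding a_eq b_eq isometry_of_eq[OF u \<theta> f] isometry_of_eq[OF v \<eta> f] s_def t_def .
    define A B where "A = ln (LINT y|M. exp (u y + s * ln (softmax w (?\<theta> y))))"
      and "B = ln (LINT y|M. exp (v y + t * ln (softmax w (?\<eta> y))))"
    have "u z + s * ln (softmax w (?\<theta> z)) - A = v z + t * ln (softmax w (?\<eta> z)) - B"
      if "z \<in> topspace K" for z
      using arg_cong[OF fun_cong[OF eq, of z], of ln] ln_softmax[OF cu that] ln_softmax[OF cv that]
      by (simp add: A_def B_def)
    from this[OF x] this[OF y] show ?thesis
      using ln_softmax[OF w] Homeo_D(5)[OF \<theta> x] Homeo_D(5)[OF \<theta> y]
        Homeo_D(5)[OF \<eta> x] Homeo_D(5)[OF \<eta> y]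
      by (simp add: algebra_simps)
  qed
  \<comment> \<open>The zero test function isolates the weights.\<close>
  have uv: "u x - u y = v x - v y" if "x \<in> topspace K" "y \<in> topspace K" for x y
    using rel[of "\<lambda>x. 0" x y] that by simp
  have rel': "s * (w (?\<theta> x) - w (?\<theta> y)) = t * (w (?\<eta> x) - w (?\<eta> y))"
    if "continuous_map K euclideanreal w" "x \<in> topspace K" "y \<in> topspace K" for w x y
    using rel[OF that] uv[OF that(2,3)] by linarith
  have \<theta>_inj: "?\<theta> x \<noteq> ?\<theta> y" if "x \<in> topspace K" "y \<in> topspace K" "x \<noteq> y" for x y
    using that Homeo_D(7)[OF \<theta>] by metis
  have same: "?\<theta> x = ?\<eta> x" if x: "x \<in> topspace K" for x
  proof (rule ccontr)
    assume ne: "?\<theta> x \<noteq> ?\<eta> x"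
    obtain z where z: "z \<in> topspace K" "z \<noteq> ?\<theta> x" "z \<noteq> ?\<eta> x" using third by blast
    \<comment> \<open>Now \<open>?\<eta>\<close> sends \<open>x\<close> and \<open>y\<close> to
      \<open>?\<eta> x\<close> and \<open>z\<close>, both different from \<open>?\<theta> x\<close>.
      A function that is 1 at \<open>?\<theta> x\<close> and 0 at these points and at
      \<open>?\<theta> y\<close> makes one side of \<open>rel'\<close> equal to \<open>s\<close> and
      the other zero.\<close>
    define y where "y = \<eta> z"
    have y: "y \<in> topspace K" "?\<eta> y = z" using Homeo_D(4,6)[OF \<eta> z(1)] by (auto simp: y_def)
    then have "x \<noteq> y" using z(3) by auto
    then have "?\<theta> x \<notin> {?\<eta> x, z, ?\<theta> y}" using ne z \<theta>_inj[OF x y(1)] by auto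
    moreover have "{?\<eta> x, z, ?\<theta> y} \<subseteq> topspace K"
      using z(1) Homeo_D(5)[OF \<theta> y(1)] Homeo_D(5)[OF \<eta> x] by simp
    ultimately obtain w where w: "continuous_map K euclideanreal w" "w (?\<theta> x) = 1"
      "\<forall>p\<in>{?\<eta> x, z, ?\<theta> y}. w p = 0"
      using finite_indicator[OF Homeo_D(5)[OF \<theta> x], of "{?\<eta> x, z, ?\<theta> y}"] by auto
    then show False using rel'[OF w(1) x y(1)] st y(2) by simp
  qed
  have "\<theta> x = \<eta> x" for x
  proof (cases "x \<in> topspace K")
    case True
    then have "?\<theta> (\<eta> x) = x" using same[OF Homeo_D(4)[OF \<eta> True]] Homeo_D(6)[OF \<eta> True] by simp
    then show ?thesis using Homeo_D(7)[OF \<theta> Homeo_D(4)[OF \<eta> True]] by simp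
  qed (use Homeo_D(2)[OF \<theta>] Homeo_D(2)[OF \<eta>] in \<open>simp add: extensional_def\<close>)
  then have "\<theta> = \<eta>" by blast
  moreover have "k = l"
  proof -
    obtain x where x: "x \<in> topspace K" using nonempty by blast
    obtain y where y: "y \<in> topspace K" "y \<noteq> x" using third[of x x] by blast
    obtain w where w: "continuous_map K euclideanreal w" "w (?\<theta> x) = 1" "\<forall>p\<in>{?\<theta> y}. w p = 0"
      using finite_indicator[OF Homeo_D(5)[OF \<theta> x], of "{?\<theta> y}"] \<theta>_inj[OF x y(1)] y
        Homeo_D(5)[OF \<theta> y(1)] by auto
    have "s = t" using rel'[OF w(1) x y(1)] w same[OF x] same[OF y(1)] by simp
    then show ?thesis using k l by (auto simp: s_def t_def)
  qed
  moreover have "cls K u = cls K v" using uv unfolding cls_eq_iff by blast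
  ultimately show "a = b" by (simp add: a_eq b_eq)
qed

theorem Isom_iso:
  assumes "infinite (topspace K) \<or> 3 \<le> card (topspace K)"
  shows "Isom (Delta K M) (hilbert_dist K M) \<cong> isometry_group_model K"
proof -
  have "isometry_of ` carrier (isometry_group_model K) = carrier (Isom (Delta K M) (hilbert_dist K M))"
    using isometry_of_Isom isometry_of_surj by blast
  then have "isometry_of \<in> iso (isometry_group_model K) (Isom (Delta K M) (hilbert_dist K M))"
    using isometry_of_hom isometry_of_inj[OF assms] by (intro isoI) (simp_all add: bij_betw_def)
  moreover have "a \<otimes>\<^bsub>isometry_group_model K\<^esub> b \<in> carrier (isometry_group_model K)"
    if a: "a \<in> carrier (isometry_group_model K)" and b: "b \<in> carrier (isometry_group_model K)" for a b
  proof -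
    obtain u k \<theta> where a_eq: "a = (cls K u, k, \<theta>)" and u: "continuous_map K euclideanreal u"
      and k: "k \<in> {0, 1}" and \<theta>: "\<theta> \<in> carrier (Homeo K)"
      using a by (rule modelE)
    obtain v l \<eta> where b_eq: "b = (cls K v, l, \<eta>)" and v: "continuous_map K euclideanreal v"
      and l: "l \<in> {0, 1}" and \<eta>: "\<eta> \<in> carrier (Homeo K)"
      using b by (rule modelE)
    have "(k + l) mod 2 \<in> {0, 1}" using k l by auto
    then show ?thesis
      unfolding a_eq b_eq mult_model[OF u v k \<theta>]
      by (intro modelI cont_action[OF u v \<theta>] Homeo_mult(1)[OF \<theta> \<eta>])
  qed
  ultimately show ?thesis by (intro is_isoI) (rule iso_inv_into)
qed

end

text \<open>Over the empty space every integral is zero, never one.\<close>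

lemma Delta_empty:
  assumes "finite_Borel_measure K M" "topspace K = {}"
  shows "Delta K M = {}"
proof -
  have "(LINT x|M. f x) = (LINT x|M. 0)" for f :: "'a \<Rightarrow> real"
    using finite_Borel_measure_space[OF assms(1)] assms(2)
    by (intro Bochner_Integration.integral_cong) auto
  then show ?thesis by (auto simp: Delta_def)
qed

theorem theorem1p2:
  fixes K1 :: "'a topology" and K2 :: "'b topology"
    and M1 :: "'a measure" and M2 :: "'b measure"
  assumes "compact_space K1" and "Hausdorff_space K1"
    and "finite_Borel_measure K1 M1" and "strictly_positive K1 M1"
    and "compact_space K2" and "Hausdorff_space K2"
    and "finite_Borel_measure K2 M2" and "strictly_positive K2 M2"
  shows
    "(\<forall>h \<in> Delta K1 M1 \<rightarrow> Delta K2 M2.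
        surjective_isometry (Delta K1 M1) (hilbert_dist K1 M1) (Delta K2 M2) (hilbert_dist K2 M2) h
        \<longleftrightarrow>
        (\<exists>\<epsilon> \<in> {-1, 1::int}. \<exists>\<theta> g.
           homeomorphic_map K2 K1 \<theta> \<and>
           g \<in> C_space K2 \<and> (\<forall>x \<in> topspace K2. 0 < g x) \<and>
           (\<forall>f \<in> Delta K1 M1.
              h f = (\<lambda>x \<in> topspace K2.
                g x * f (\<theta> x) powi \<epsilon> / (LINT y|M2. g y * f (\<theta> y) powi \<epsilon>))))) \<and>
     (infinite (topspace K1) \<or> 3 \<le> card (topspace K1) \<longrightarrow>
        Isom (Delta K1 M1) (hilbert_dist K1 M1) \<cong>
        semidirect_product (C_bar K1) (integer_mod_group 2 \<times>\<times> Homeo K1) (C_bar_action K1))"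
    (is "(\<forall>h \<in> _. ?iso h \<longleftrightarrow> ?form h) \<and> (?three \<longrightarrow> ?group)")
proof (intro conjI ballI impI)
  have mc1: "measured_compact K1 M1" if "topspace K1 \<noteq> {}"
    using assms that by unfold_locales
  have mc2: "measured_compact K2 M2" if "topspace K2 \<noteq> {}"
    using assms that by unfold_locales
  have ne: "Delta K M \<noteq> {}" if "measured_compact K M" for K :: "'c topology" and M
    using measured_compact.softmax_Delta[OF that, of "\<lambda>x. 0"] by auto
  show ?group if ?three
  proof -
    have "topspace K1 \<noteq> {}" using that by auto
    then show ?thesis using measured_compact.Isom_iso[OF mc1 that] by blast
  qed
  fix h assume h: "h \<in> Delta K1 M1 \<rightarrow> Delta K2 M2"
  \<comment> \<open>Only when both spaces are nonempty does the locale argument apply. If both are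
    empty, both sides hold; if just the first is empty, both fail, as there is no surjection onto a
    nonempty set.\<close>
  consider "topspace K1 = {}" "topspace K2 = {}" | "topspace K1 = {}" "topspace K2 \<noteq> {}"
    | "topspace K1 \<noteq> {}" "topspace K2 = {}" | "topspace K1 \<noteq> {}" "topspace K2 \<noteq> {}"
    by blast
  then show "?iso h \<longleftrightarrow> ?form h"
  proof cases
    case 1
    then have "Delta K1 M1 = {}" "Delta K2 M2 = {}" using assms Delta_empty by blast+
    moreover have "homeomorphic_map K2 K1 \<theta>" for \<theta>
      using 1 null_topspace_iff_trivial by (simp add: homeomorphic_map_def quotient_map_def)
    moreover have "(\<lambda>x\<in>topspace K2. 1) \<in> C_space K2" 
      using 1 by (auto simp: C_space_def continuous_map_def)
    ultimately show ?thesis using 1 by (auto simp: surjective_isometry_def)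
  next
    case 2
    then have "Delta K1 M1 = {}" using assms Delta_empty by blast
    moreover have "Delta K2 M2 \<noteq> {}" using ne[OF mc2] 2 by blast
    moreover have "\<not> homeomorphic_map K2 K1 \<theta>" for \<theta>
      using 2 homeomorphic_imp_surjective_map[of K2 K1 \<theta>] by auto
    ultimately show ?thesis by (auto simp: surjective_isometry_def)
  next
    \<comment> \<open>Here \<open>h\<close> would map a nonempty set into the empty set, so the case
      is void.\<close>
    case 3
    then have "Delta K2 M2 = {}" using assms Delta_empty by blast
    moreover have "Delta K1 M1 \<noteq> {}" using ne[OF mc1] 3 by blast
    ultimately show ?thesis using h by auto
  next
    case 4
    then interpret two_measured_compact K1 M1 K2 M2
      using mc1 mc2 by (simp add: two_measured_compact_def)
    show ?thesis by (rule surjective_isometry_iff)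
  qed
qed

end
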